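(* Let $d,k\ge1$, let $\mathbf{\Lambda}_j=(\lambda_{j1},\dots,\lambda_{jd})\succ\mathbf{0}$, $j=1,\dots,k$, let $\boldsymbol{\alpha}=(\alpha_1,\dots,\alpha_d)$ with $\alpha_i\in(0,1)$, let $\{\mathscr{M}(\mathbf{t})\}_{\mathbf{t}\in\mathbb{R}^d_+}$ be a multiparameter GCP with transition parameters $\mathbf{\Lambda}_j$, $j=1,\dots,k$, and let $\boldsymbol{\mathscr{L}}_{\boldsymbol{\alpha}}(\mathbf{t})=(L_1^{\alpha_1}(t_1),\dots,L_d^{\alpha_d}(t_d))$, $\mathbf{t}\in\mathbb{R}^d_+$, be a multiparameter inverse stable subordinator independent of $\{\mathscr{M}(\mathbf{t})\}$. Let $\mathscr{M}_{\boldsymbol{\alpha}}(\mathbf{t})=\mathscr{M}(\boldsymbol{\mathscr{L}}_{\boldsymbol{\alpha}}(\mathbf{t}))$, $\mathbf{t}\in\mathbb{R}^d_+$, be the multiparameter fractional GCP. Then its distribution $p_{\boldsymbol{\alpha}}(n,\mathbf{t})=\mathrm{Pr}\{\mathscr{M}_{\boldsymbol{\alpha}}(\mathbf{t})=n\}$, $n\ge0$, is given by $$p_{\boldsymbol{\alpha}}(n,\mathbf{t})=\sum_{\Omega(k,n)}\ \sum_{\substack{\Theta(n_j,d)\\ j=1,2,\dots,k}}\ \prod_{i=1}^{d}\Big(\sum_{j=1}^{k}n_{ji}\Big)!\Big(\prod_{j=1}^{k}\frac{(\lambda_{ji}t_i^{\alpha_i})^{n_{ji}}}{n_{ji}!}\Big)E_{\alpha_i,\,\alpha_i\sum_{j=1}^{k}n_{ji}+1}^{\sum_{j=1}^{k}n_{ji}+1}\Big(-t_i^{\alpha_i}\sum_{j=1}^{k}\lambda_{ji}\Big),$$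 where $\Omega(k,n)=\{(n_1,\dots,n_k):\sum_{j=1}^{k}jn_j=n,\ n_j\in\mathbb{N}_0\}$ and $\Theta(n_j,d)=\{(n_{j1},\dots,n_{jd}):0\le n_{ji}\le n_j,\ \sum_{i=1}^{d}n_{ji}=n_j\}$ (with integer $n_{ji}$; the inner sum runs over all choices of one element of $\Theta(n_j,d)$ for each $j=1,\dots,k$). Also, for $i=1,2,\dots,d$, this distribution solves the system of fractional differential equations $$\mathcal{D}_{t_i}^{\alpha_i}p_{\boldsymbol{\alpha}}(n,\mathbf{t})=-\sum_{j=1}^{k}\lambda_{ji}\big(p_{\boldsymbol{\alpha}}(n,\mathbf{t})-p_{\boldsymbol{\alpha}}(n-j,\mathbf{t})\big),\quad n\ge0,$$ where $\mathcal{D}_{t_i}^{\alpha_i}$ is the Caputo fractional derivative of order $\alpha_i$ in the variable $t_i$.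
   Context: $\mathbb{R}_+=[0,\infty)$, $\mathbb{N}_0=\{0,1,2,\dots\}$, $\mathbf{t}\cdot\mathbf{s}=\sum_{i=1}^d t_is_i$; $\mathbf{s}\preceq\mathbf{t}$ means $s_i\le t_i$ for all $i$, and $\mathbf{s}\prec\mathbf{t}$ means $s_i<t_i$ for all $i$. $\overset{d}{=}$ denotes equality in distribution. By convention $p_{\boldsymbol{\alpha}}(m,\mathbf{t})=0$ for $m<0$. An integer-valued random process $\{\mathcal{N}(\mathbf{t})\}_{\mathbf{t}\in\mathbb{R}^d_+}$ is a multiparameter counting process if $\mathcal{N}(\mathbf{0})=0$, $\mathcal{N}(\mathbf{t})\ge0$ for all $\mathbf{t}$, and $\mathcal{N}(\mathbf{s})\le\mathcal{N}(\mathbf{t})$ whenever $\mathbf{s}\preceq\mathbf{t}$. A multiparameter counting process $\{\mathscr{M}(\mathbf{t})\}_{\mathbf{t}\in\mathbb{R}^d_+}$ is a multiparameter GCP (generalized counting process) with transition parameters $\mathbf{\Lambda}_j\succ\mathbf{0}$, $j=1,\dots,k$, if: (i) $\mathscr{M}(\mathbf{0})=0$; (ii) whenever $\mathbf{0}=\mathbf{t}^{(0)}\prec\mathbf{t}^{(1)}\prec\dots\prec\mathbf{t}^{(n)}$, the increments $\mathscr{M}(\mathbf{t}^{(1)})-\mathscr{M}(\mathbf{t}^{(0)}),\dots,\mathscr{M}(\mathbf{t}^{(n)})-\mathscr{M}(\mathbf{t}^{(n-1)})$ are mutually independent; (iii) $\mathscr{M}(\mathbf{t})-\mathscr{M}(\mathbf{s})\overset{d}{=}\mathscr{M}(\mathbf{t}-\mathbf{s})$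 whenever $\mathbf{s}\preceq\mathbf{t}$; (iv) $\mathrm{Pr}(\mathscr{M}(\mathbf{t})=n)=\sum_{(x_1,\dots,x_k)\in\mathbb{N}_0^k:\ \sum_j jx_j=n}\ \prod_{j=1}^{k}\frac{(\mathbf{\Lambda}_j\cdot\mathbf{t})^{x_j}}{x_j!}e^{-\mathbf{\Lambda}_j\cdot\mathbf{t}}$ for $n\ge0$. For $\alpha\in(0,1)$, an $\alpha$-stable subordinator $\{D^{\alpha}(t)\}_{t\ge0}$ is a subordinator with $\mathbb{E}e^{-wD^\alpha(t)}=e^{-tw^\alpha}$, $w>0$; its inverse is $L^\alpha(t)=\inf\{u>0:D^\alpha(u)>t\}$, called the inverse $\alpha$-stable subordinator. A multiparameter inverse stable subordinator is $\boldsymbol{\mathscr{L}}_{\boldsymbol{\alpha}}(\mathbf{t})=(L_1^{\alpha_1}(t_1),\dots,L_d^{\alpha_d}(t_d))$ where the $\{L_i^{\alpha_i}(t)\}_{t\ge0}$ are independent inverse $\alpha_i$-stable subordinators. The three-parameter Mittag-Leffler function is $E_{\alpha,\beta}^{\gamma}(x)=\frac{1}{\Gamma(\gamma)}\sum_{j=0}^{\infty}\frac{\Gamma(j+\gamma)x^j}{j!\,\Gamma(j\alpha+\beta)}$, $x\in\mathbb{R}$, $\alpha,\beta,\gamma>0$. The Caputo fractional derivative of order $\alpha\in(0,1)$ is $\mathcal{D}_t^\alpha f(t)=\frac{1}{\Gamma(1-\alpha)}\int_0^t(t-s)^{-\alpha}f'(s)\,\mathrm{d}s$, $t>0$. *)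

theory Defs
  imports "HOL-Probability.Probability"
begin

text \<open>
  The order on \<^typ>\<open>real ^ 'd\<close> is the componentwise weak order; the library's strict order
  on vectors is not the componentwise strict one, hence the following.
\<close>

definition vec_prec :: "real ^ 'd \<Rightarrow> real ^ 'd \<Rightarrow> bool" (infix \<open>\<prec>\<close> 50)
  where "s \<prec> t \<longleftrightarrow> (\<forall>i. s $ i < t $ i)"

definition vec_upd :: "real ^ 'd \<Rightarrow> 'd \<Rightarrow> real \<Rightarrow> real ^ 'd"
  where "vec_upd t i x = (\<chi> l. if l = i then x else t $ l)"

definition Omega :: "nat \<Rightarrow> nat \<Rightarrow> (nat \<Rightarrow> nat) set"
  where "Omega k n = {x \<in> {1..k} \<rightarrow>\<^sub>E UNIV. (\<Sum>j = 1..k. j * x j) = n}"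

definition Theta :: "nat \<Rightarrow> ('d::finite \<Rightarrow> nat) set"
  where "Theta m = {v. (\<forall>i. v i \<le> m) \<and> (\<Sum>i\<in>UNIV. v i) = m}"

definition mittag_leffler3 :: "real \<Rightarrow> real \<Rightarrow> real \<Rightarrow> real \<Rightarrow> real"
  where "mittag_leffler3 \<alpha> \<beta> \<gamma> x =
    1 / Gamma \<gamma> * (\<Sum>j. Gamma (real j + \<gamma>) * x ^ j / (fact j * Gamma (real j * \<alpha> + \<beta>)))"

definition caputo_deriv :: "real \<Rightarrow> (real \<Rightarrow> real) \<Rightarrow> real \<Rightarrow> real"
  where "caputo_deriv \<alpha> f t =
    1 / Gamma (1 - \<alpha>) * (LINT s:{0<..<t}|lborel. (t - s) powr (- \<alpha>) * deriv f s)"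

text \<open>
  Well-definedness of the right-hand side above; without it \<^const>\<open>deriv\<close> is arbitrary and the
  Lebesgue integral is 0 by convention.
\<close>

definition caputo_differentiable :: "real \<Rightarrow> (real \<Rightarrow> real) \<Rightarrow> real \<Rightarrow> bool"
  where "caputo_differentiable \<alpha> f t \<longleftrightarrow>
    (\<forall>s\<in>{0<..<t}. f differentiable (at s)) \<and>
    set_integrable lborel {0<..<t} (\<lambda>s. (t - s) powr (- \<alpha>) * deriv f s)"

text \<open>
  Processes are indexed by all of \<^typ>\<open>real\<close> or \<^typ>\<open>real ^ 'd\<close>, but only the values at
  nonnegative times are constrained.
\<close>

context prob_space
begin

definition multiparameter_counting_process :: "(real ^ 'd \<Rightarrow> 'a \<Rightarrow> int) \<Rightarrow> bool"
  where "multiparameter_counting_process N \<longleftrightarrow>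
    (\<forall>t\<ge>0. random_variable (count_space UNIV) (N t)) \<and>
    (\<forall>\<omega>\<in>space M. N 0 \<omega> = 0) \<and>
    (\<forall>\<omega>\<in>space M. \<forall>t\<ge>0. 0 \<le> N t \<omega>) \<and>
    (\<forall>\<omega>\<in>space M. \<forall>s t. 0 \<le> s \<longrightarrow> s \<le> t \<longrightarrow> N s \<omega> \<le> N t \<omega>)"

definition multiparameter_GCP ::
    "nat \<Rightarrow> (nat \<Rightarrow> real ^ 'd) \<Rightarrow> (real ^ 'd \<Rightarrow> 'a \<Rightarrow> int) \<Rightarrow> bool"
  where "multiparameter_GCP k \<Lambda> N \<longleftrightarrow>
    multiparameter_counting_process N \<and>
    (\<forall>\<omega>\<in>space M. N 0 \<omega> = 0) \<and>
    (\<forall>n \<tau>. \<tau> 0 = 0 \<longrightarrow> (\<forall>i<n. \<tau> i \<prec> \<tau> (Suc i)) \<longrightarrow>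
      indep_vars (\<lambda>_. count_space UNIV) (\<lambda>i \<omega>. N (\<tau> (Suc i)) \<omega> - N (\<tau> i) \<omega>) {..<n}) \<and>
    (\<forall>s t. 0 \<le> s \<longrightarrow> s \<le> t \<longrightarrow>
      distr M (count_space UNIV) (\<lambda>\<omega>. N t \<omega> - N s \<omega>) =
      distr M (count_space UNIV) (N (t - s))) \<and>
    (\<forall>t\<ge>0. \<forall>n. prob {\<omega> \<in> space M. N t \<omega> = int n} =
      (\<Sum>x\<in>Omega k n. \<Prod>j = 1..k.
        (\<Lambda> j \<bullet> t) ^ x j / fact (x j) * exp (- (\<Lambda> j \<bullet> t))))"

text \<open>Left limits need not be required, as the paths are nondecreasing.\<close>

definition subordinator :: "(real \<Rightarrow> 'a \<Rightarrow> real) \<Rightarrow> bool"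
  where "subordinator D \<longleftrightarrow>
    (\<forall>t\<ge>0. random_variable borel (D t)) \<and>
    (AE \<omega> in M. D 0 \<omega> = 0 \<and> (\<forall>s t. 0 \<le> s \<longrightarrow> s \<le> t \<longrightarrow> D s \<omega> \<le> D t \<omega>) \<and>
      (\<forall>t\<ge>0. continuous (at_right t) (\<lambda>u. D u \<omega>))) \<and>
    (\<forall>n \<tau>. \<tau> 0 = 0 \<longrightarrow> (\<forall>i<n. \<tau> i < \<tau> (Suc i)) \<longrightarrow>
      indep_vars (\<lambda>_. borel) (\<lambda>i \<omega>. D (\<tau> (Suc i)) \<omega> - D (\<tau> i) \<omega>) {..<n}) \<and>
    (\<forall>s t. 0 \<le> s \<longrightarrow> s \<le> t \<longrightarrow>
      distr M borel (\<lambda>\<omega>. D t \<omega> - D s \<omega>) = distr M borel (D (t - s)))"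

definition stable_subordinator :: "real \<Rightarrow> (real \<Rightarrow> 'a \<Rightarrow> real) \<Rightarrow> bool"
  where "stable_subordinator \<alpha> D \<longleftrightarrow>
    subordinator D \<and>
    (\<forall>t\<ge>0. \<forall>w>0. expectation (\<lambda>\<omega>. exp (- w * D t \<omega>)) = exp (- t * w powr \<alpha>))"

text \<open>
  The set below is nonempty for almost every \<open>\<omega>\<close>, since a stable subordinator is almost surely
  unbounded; on the exceptional null set the value of \<open>L\<close> is irrelevant.
\<close>

definition inverse_stable_subordinator :: "real \<Rightarrow> (real \<Rightarrow> 'a \<Rightarrow> real) \<Rightarrow> bool"
  where "inverse_stable_subordinator \<alpha> L \<longleftrightarrow>
    (\<exists>D. stable_subordinator \<alpha> D \<and>
      (\<forall>t\<ge>0. \<forall>\<omega>\<in>space M. L t \<omega> = Inf {u. 0 < u \<and> t < D u \<omega>}))"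

text \<open>
  Independence of processes is independence of the sigma-algebras they generate as random elements
  of product spaces. Both \<^const>\<open>indep_vars\<close> and \<^const>\<open>indep_set\<close> include measurability with respect to \<open>M\<close>,
  so the value of each process at each time is a random variable.
\<close>

definition multiparameter_inverse_stable_subordinator ::
    "real ^ 'd \<Rightarrow> (real ^ 'd \<Rightarrow> 'a \<Rightarrow> real ^ 'd) \<Rightarrow> bool"
  where "multiparameter_inverse_stable_subordinator \<alpha> L \<longleftrightarrow>
    (\<exists>l. (\<forall>i. inverse_stable_subordinator (\<alpha> $ i) (l i)) \<and>
      indep_vars (\<lambda>_. Pi\<^sub>M {0..} (\<lambda>_. borel)) (\<lambda>i \<omega>. \<lambda>s\<in>{0..}. l i s \<omega>) UNIV \<and>
      (\<forall>t\<ge>0. \<forall>\<omega>\<in>space M. L t \<omega> = (\<chi> i. l i (t $ i) \<omega>)))"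

definition indep_processes ::
    "(real ^ 'd \<Rightarrow> 'a \<Rightarrow> int) \<Rightarrow> (real ^ 'd \<Rightarrow> 'a \<Rightarrow> real ^ 'd) \<Rightarrow> bool"
  where "indep_processes N L \<longleftrightarrow>
    indep_set
      (sets (vimage_algebra (space M) (\<lambda>\<omega>. \<lambda>t\<in>{0..}. N t \<omega>) (Pi\<^sub>M {0..} (\<lambda>_. count_space UNIV))))
      (sets (vimage_algebra (space M) (\<lambda>\<omega>. \<lambda>t\<in>{0..}. L t \<omega>) (Pi\<^sub>M {0..} (\<lambda>_. borel))))"

end

definition fractional_GCP ::
    "(real ^ 'd \<Rightarrow> 'a \<Rightarrow> int) \<Rightarrow> (real ^ 'd \<Rightarrow> 'a \<Rightarrow> real ^ 'd) \<Rightarrow> real ^ 'd \<Rightarrow> 'a \<Rightarrow> int"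
  where "fractional_GCP N L t \<omega> = N (L t \<omega>) \<omega>"

text \<open>
  No path regularity beyond monotonicity is assumed of the counting process, so the event
  \<open>N (L t) = m\<close> need not belong to the given sigma-algebra, only to its completion.
  Probabilities are therefore taken in the completion, which agrees with \<open>P\<close> on the events
  of \<open>P\<close>.
\<close>

definition fractional_GCP_prob ::
    "'a measure \<Rightarrow> (real ^ 'd \<Rightarrow> 'a \<Rightarrow> int) \<Rightarrow> (real ^ 'd \<Rightarrow> 'a \<Rightarrow> real ^ 'd) \<Rightarrow>
      int \<Rightarrow> real ^ 'd \<Rightarrow> real"
  where "fractional_GCP_prob P N L m t =
    (if m < 0 then 0
     else measure (completion P) {\<omega> \<in> space P. fractional_GCP N L t \<omega> = m})"

end

theory Submission
  imports Defs
begin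

text \<open>
  Let \<open>q n u\<close> be the probability mass function of the counting process at the deterministic time
  \<open>u\<close>. Paths are monotone and \<open>q\<close> is continuous, so squeezing \<open>L t\<close> between countably valued
  times gives \<open>p n t = E (q n (L t))\<close>. The multinomial theorem writes \<open>q n u\<close> as a
  finite combination of products of factors \<open>u $ i ^ m * exp (- c $ i * u $ i)\<close>, so that by independence only the
  expectations of \<open>l ^ m * exp (- c * l)\<close> at an inverse stable time \<open>l\<close> are needed. Uniqueness of Laplace
  transforms shows that \<open>l\<close> has the law of \<open>(t / D 1) powr \<alpha>\<close>, whence its moments
  \<open>m! t powr (m \<alpha>) / Gamma (m \<alpha> + 1)\<close>, and expanding the exponential gives the Mittag-Leffler series.

  On power series in \<open>t powr \<alpha>\<close> the Caputo derivative shifts the coefficients of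
  \<open>(t powr \<alpha>) ^ r / Gamma (\<alpha> r + 1)\<close>. Hence it maps the expectation of \<open>f l\<close> to that of
  \<open>f' l\<close> for \<open>f x = x ^ m * exp (- c * x)\<close>, and the fractional equations follow from the ordinary
  differential equations of \<open>q\<close> in the variable \<open>u $ i\<close>.
\<close>

section \<open>Expansion and differential equation of the probability mass function\<close>

text \<open>Time enters \<open>p\<close> only through the law of \<open>L t\<close>, so no
  derivative is taken under the expectation. Instead one function, the partial derivative of
  \<open>q n\<close> in \<open>u $ i\<close>, is evaluated at \<open>L t\<close>, and its
  expectation is computed twice: from the monomial expansion it is the Caputo derivative of
  \<open>p\<close>, from the Poisson form it is the right-hand side of the equation. That both forms
  agree is uniqueness of derivatives, which replaces a combinatorial comparison of index sets.

  The moments rest on Gamma(s) x^(-s) = integral of w^(s-1) exp(-w x) over w > 0. Averaging over x =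
  \<open>D 1\<close> leaves an integral of w^(s-1) exp(-w^\<alpha>), so the Laplace transform
  suffices and no stable density occurs. The interchanges of power series with integrals rest on one
  estimate: Gamma(\<alpha> r + 1) outgrows every geometric sequence, while the coefficients in play
  grow at most geometrically.\<close>

lemma finite_fixed_sum_funs:
  fixes n :: nat
  assumes "finite S"
  shows "finite {v. (\<forall>i. i \<notin> S \<longrightarrow> v i = 0) \<and> sum v S = n}"
proof (rule finite_subset)
  show "finite {v. \<forall>i. (i \<in> S \<longrightarrow> v i \<in> {..n}) \<and> (i \<notin> S \<longrightarrow> v i = 0)}"
    using assms by (intro finite_set_of_finite_funs) auto
  show "{v. (\<forall>i. i \<notin> S \<longrightarrow> v i = 0) \<and> sum v S = n} \<subseteq>
      {v. \<forall>i. (i \<in> S \<longrightarrow> v i \<in> {..n}) \<and> (i \<notin> S \<longrightarrow> v i = 0)}"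
    using assms by (auto intro: member_le_sum)
qed

lemma binomial_fact_expansion:
  fixes a b :: "'a::field_char_0"
  shows "(a + b) ^ n / fact n = (\<Sum>m\<le>n. a ^ m / fact m * (b ^ (n - m) / fact (n - m)))"
proof -
  have "(a + b) ^ n / fact n = (\<Sum>m\<le>n. of_nat (n choose m) * a ^ m * b ^ (n - m) / fact n)"
    by (simp add: binomial_ring sum_divide_distrib)
  also have "\<dots> = (\<Sum>m\<le>n. a ^ m / fact m * (b ^ (n - m) / fact (n - m)))"
    by (intro sum.cong refl) (simp add: binomial_fact field_simps)
  finally show ?thesis .
qed

text \<open>Induction on \<open>S\<close> splits off one summand by the binomial formula; dividing
  by factorials makes the multinomial coefficients disappear. Fixing \<open>v i = 0\<close> off
  \<open>S\<close> represents each exponent vector by exactly one total function.\<close>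

lemma multinomial_fact_expansion:
  fixes a :: "'i \<Rightarrow> 'a::field_char_0"
  assumes "finite S"
  shows "(\<Sum>i\<in>S. a i) ^ n / fact n =
    (\<Sum>v | (\<forall>i. i \<notin> S \<longrightarrow> v i = 0) \<and> sum v S = n. \<Prod>i\<in>S. a i ^ v i / fact (v i))"
  using assms
proof (induction S arbitrary: n rule: finite_induct)
  case empty
  show ?case
  proof (cases n)
    case 0
    have "{v::'i \<Rightarrow> nat. \<forall>i. v i = 0} = {\<lambda>_. 0}" by auto
    with 0 show ?thesis by simp
  qed simp
next
  case (insert s S)
  let ?T = "\<lambda>S n. {v::'i \<Rightarrow> nat. (\<forall>i. i \<notin> S \<longrightarrow> v i = 0) \<and> sum v S = n}"
  have upd: "sum (v(s := m)) S = sum v S" "(\<Prod>i\<in>S. a i ^ (v(s := m)) i / fact ((v(s := m)) i)) =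
      (\<Prod>i\<in>S. a i ^ v i / fact (v i))" for v m
    using insert.hyps by (auto intro!: sum.cong prod.cong)
  have "(\<Sum>i\<in>insert s S. a i) ^ n / fact n =
      (\<Sum>m\<le>n. a s ^ m / fact m * (\<Sum>v\<in>?T S (n - m). \<Prod>i\<in>S. a i ^ v i / fact (v i)))"
    using insert by (simp add: binomial_fact_expansion)
  also have "\<dots> = (\<Sum>(m, v)\<in>Sigma {..n} (\<lambda>m. ?T S (n - m)).
      a s ^ m / fact m * (\<Prod>i\<in>S. a i ^ v i / fact (v i)))"
    using insert.hyps by (simp add: sum_distrib_left sum.Sigma finite_fixed_sum_funs)
  also have "\<dots> = (\<Sum>v\<in>?T (insert s S) n. \<Prod>i\<in>insert s S. a i ^ v i / fact (v i))"
  \<comment> \<open>A vector on \<open>insert s S\<close> corresponds to its entry at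
    \<open>s\<close> paired with the same vector reset to 0 at \<open>s\<close>.\<close>
  proof (rule sum.reindex_bij_witness[where i = "\<lambda>v. (v s, v(s := 0))" and j = "\<lambda>(m, v). v(s := m)"])
    fix p assume p: "p \<in> Sigma {..n} (\<lambda>m. ?T S (n - m))"
    obtain m v where mv: "p = (m, v)" by force
    have v: "v s = 0" using p mv insert.hyps by auto
    show "(\<lambda>v. (v s, v(s := 0))) ((\<lambda>(m, v). v(s := m)) p) = p"
      using mv v by (auto simp: fun_eq_iff)
    show "(case p of (m, v) \<Rightarrow> v(s := m)) \<in> ?T (insert s S) n"
      using p mv insert.hyps upd by (auto simp del: fun_upd_apply simp: fun_upd_same fun_upd_other)
    show "(\<Prod>i\<in>insert s S. a i ^ ((case p of (m, v) \<Rightarrow> v(s := m)) i) /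
        fact ((case p of (m, v) \<Rightarrow> v(s := m)) i)) =
        (case p of (m, v) \<Rightarrow> a s ^ m / fact m * (\<Prod>i\<in>S. a i ^ v i / fact (v i)))"
      using mv insert.hyps upd(2)[of v m] by (simp del: fun_upd_apply add: fun_upd_same)
  next
    fix v assume v: "v \<in> ?T (insert s S) n"
    show "(v s, v(s := 0)) \<in> Sigma {..n} (\<lambda>m. ?T S (n - m))"
      using v insert.hyps upd(1)[of v 0] by (auto simp del: fun_upd_apply simp: fun_upd_same fun_upd_other) auto
  qed auto
  finally show ?case .
qed

lemma finite_Omega: "finite (Omega k n)"
proof (rule finite_subset)
  show "finite ({1..k} \<rightarrow>\<^sub>E {..n})" by (intro finite_PiE) auto
  show "Omega k n \<subseteq> {1..k} \<rightarrow>\<^sub>E {..n}"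
  proof
    fix x assume x: "x \<in> Omega k n"
    have "x j \<le> n" if "j \<in> {1..k}" for j
    proof -
      have "x j \<le> j * x j" using that by simp
      also have "\<dots> \<le> (\<Sum>j = 1..k. j * x j)" using that by (intro member_le_sum) auto
      finally show ?thesis using x by (simp add: Omega_def)
    qed
    with x show "x \<in> {1..k} \<rightarrow>\<^sub>E {..n}" by (auto simp: Omega_def PiE_def Pi_def)
  qed
qed

text \<open>In this form \<open>Theta m\<close> is the index set that the multinomial expansion
  produces for \<open>S = UNIV\<close>.\<close>

lemma Theta_eq: "Theta m = {v. (\<forall>i. i \<notin> UNIV \<longrightarrow> v i = 0) \<and> sum v UNIV = m}"
  by (auto simp: Theta_def intro: member_le_sum)

lemma finite_Theta: "finite (Theta m)"
  unfolding Theta_eq by (rule finite_fixed_sum_funs) simp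

text \<open>Taken as a function on the whole vector space and not only on the orthant where it is a
  probability, so that continuity and partial derivatives have no boundary cases.\<close>

definition gcp_pmf :: "nat \<Rightarrow> (nat \<Rightarrow> real ^ 'd) \<Rightarrow> nat \<Rightarrow> real ^ 'd \<Rightarrow> real"
  where "gcp_pmf k \<Lambda> n u = (\<Sum>x\<in>Omega k n. \<Prod>j = 1..k.
    (\<Lambda> j \<bullet> u) ^ x j / fact (x j) * exp (- (\<Lambda> j \<bullet> u)))"

text \<open>The factor of index \<open>j\<close> is expanded over \<open>Theta (x j)\<close>, and
  the product of these sums becomes a sum over choice functions \<open>\<nu>\<close>. Regrouping by
  the coordinate \<open>i\<close> makes each factor depend on \<open>u $ i\<close> alone, the form
  to which independence of the coordinates applies.\<close>

lemma gcp_pmf_expand: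
  "gcp_pmf k \<Lambda> n u =
    (\<Sum>x\<in>Omega k n. \<Sum>\<nu>\<in>(\<Pi>\<^sub>E j\<in>{1..k}. Theta (x j)).
      \<Prod>i\<in>UNIV. (\<Prod>j = 1..k. (\<Lambda> j $ i) ^ \<nu> j i / fact (\<nu> j i)) *
        (u $ i ^ (\<Sum>j = 1..k. \<nu> j i) * exp (- (\<Sum>j = 1..k. \<Lambda> j $ i) * u $ i)))"
  unfolding gcp_pmf_def
proof (rule sum.cong[OF refl])
  fix x
  let ?w = "\<lambda>\<nu> j i. (\<Lambda> j $ i * u $ i) ^ \<nu> i / fact (\<nu> i) :: real"
  have exp: "exp (- (\<Lambda> j \<bullet> u)) = (\<Prod>i\<in>UNIV. exp (- (\<Lambda> j $ i * u $ i)))" for j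
    by (simp add: inner_vec_def exp_sum sum_negf[symmetric])
  have "(\<Prod>j = 1..k. (\<Lambda> j \<bullet> u) ^ x j / fact (x j) * exp (- (\<Lambda> j \<bullet> u))) =
      (\<Prod>j = 1..k. \<Sum>v\<in>Theta (x j). \<Prod>i\<in>UNIV. ?w v j i * exp (- (\<Lambda> j $ i * u $ i)))"
    unfolding inner_vec_def inner_real_def
    by (subst multinomial_fact_expansion)
      (simp_all add: Theta_eq prod.distrib prod_dividef sum_distrib_right exp_sum sum_negf[symmetric])
  also have "\<dots> = (\<Sum>\<nu>\<in>(\<Pi>\<^sub>E j\<in>{1..k}. Theta (x j)). \<Prod>j = 1..k. \<Prod>i\<in>UNIV.
      ?w (\<nu> j) j i * exp (- (\<Lambda> j $ i * u $ i)))"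
    by (rule prod_sum_PiE) (auto simp: finite_Theta)
  also have "\<dots> = (\<Sum>\<nu>\<in>(\<Pi>\<^sub>E j\<in>{1..k}. Theta (x j)).
      \<Prod>i\<in>UNIV. (\<Prod>j = 1..k. (\<Lambda> j $ i) ^ \<nu> j i / fact (\<nu> j i)) *
        (u $ i ^ (\<Sum>j = 1..k. \<nu> j i) * exp (- (\<Sum>j = 1..k. \<Lambda> j $ i) * u $ i)))"
    by (intro sum.cong refl, subst prod.swap)
      (simp add: prod.distrib power_mult_distrib power_sum exp_sum sum_negf[symmetric]
        sum_distrib_right prod_dividef)
  finally show "(\<Prod>j = 1..k. (\<Lambda> j \<bullet> u) ^ x j / fact (x j) * exp (- (\<Lambda> j \<bullet> u))) = \<dots>" .
qed

text \<open>Lowering entry \<open>j\<close> by one lowers the weighted sum by \<open>j\<close>, a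
  bijection from the tuples with \<open>x j \<noteq> 0\<close> onto \<open>Omega k (n - j)\<close>.
  For \<open>j > n\<close> there are no such tuples, whereas truncated subtraction would point to
  \<open>Omega k 0\<close>; hence the conditional.\<close>

lemma sum_Omega_shift:
  fixes g :: "(nat \<Rightarrow> nat) \<Rightarrow> real"
  assumes j: "j \<in> {1..k}"
  shows "(\<Sum>x\<in>Omega k n. if x j = 0 then 0 else g (x(j := x j - 1))) =
    (if j \<le> n then sum g (Omega k (n - j)) else 0)"
proof -
  have split: "(\<Sum>i = 1..k. i * (x(j := m)) i) = j * m + (\<Sum>i\<in>{1..k} - {j}. i * x i)" for x m
    using j by (subst sum.remove[of _ j]) (auto intro!: sum.cong)
  have split0: "(\<Sum>i = 1..k. i * x i) = j * x j + (\<Sum>i\<in>{1..k} - {j}. i * x i)" for x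
    using j by (subst sum.remove[of _ j]) auto
  have le: "j \<le> n" if "x \<in> Omega k n" "x j \<noteq> 0" for x
  proof -
    have "j \<le> j * x j" using that by simp
    also have "\<dots> \<le> n" using that split0[of x] by (simp add: Omega_def)
    finally show ?thesis .
  qed
  have "(\<Sum>x\<in>Omega k n. if x j = 0 then 0 else g (x(j := x j - 1))) =
      (\<Sum>x\<in>{x \<in> Omega k n. x j \<noteq> 0}. g (x(j := x j - 1)))"
    by (rule sum.mono_neutral_cong_right) (auto simp: finite_Omega)
  also have "\<dots> = (if j \<le> n then sum g (Omega k (n - j)) else 0)"
  proof (cases "j \<le> n")
    case True
    have "(\<Sum>x\<in>{x \<in> Omega k n. x j \<noteq> 0}. g (x(j := x j - 1))) = sum g (Omega k (n - j))"
    proof (rule sum.reindex_bij_witness[where j = "\<lambda>x. x(j := x j - 1)" and i = "\<lambda>x. x(j := Suc (x j))"])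
      fix x assume x: "x \<in> {x \<in> Omega k n. x j \<noteq> 0}"
      then obtain m where m: "x j = Suc m" by (cases "x j") auto
      have "x(j := x j - 1) \<in> {1..k} \<rightarrow>\<^sub>E UNIV"
        using x j by (auto simp: Omega_def PiE_def extensional_def)
      moreover have "(\<Sum>i = 1..k. i * (x(j := x j - 1)) i) = n - j"
        using x m split0[of x] unfolding split by (simp add: Omega_def)
      ultimately show "x(j := x j - 1) \<in> Omega k (n - j)"
        unfolding Omega_def by blast
      show "(x(j := x j - 1))(j := Suc ((x(j := x j - 1)) j)) = x"
        using m by (auto simp: fun_eq_iff)
    next
      fix x assume x: "x \<in> Omega k (n - j)"
      have "x(j := Suc (x j)) \<in> {1..k} \<rightarrow>\<^sub>E UNIV"
        using x j by (auto simp: Omega_def PiE_def extensional_def)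
      moreover have "(\<Sum>i = 1..k. i * (x(j := Suc (x j))) i) = n"
        using x True split0[of x] unfolding split by (simp add: Omega_def)
      ultimately show "x(j := Suc (x j)) \<in> {x \<in> Omega k n. x j \<noteq> 0}"
        unfolding Omega_def by simp
    qed auto
    with True show ?thesis by simp
  next
    case False
    with le show ?thesis by (auto intro!: sum.neutral)
  qed
  finally show ?thesis .
qed

section \<open>Forward equations of the probability mass function in one coordinate\<close>

lemma inner_vec_upd: "a \<bullet> vec_upd u i v = a \<bullet> u + a $ i * (v - u $ i)"
proof -
  have "a \<bullet> vec_upd u i v = (\<Sum>l\<in>UNIV. a $ l * u $ l + (if l = i then a $ i * (v - u $ i) else 0))"
    unfolding inner_vec_def by (intro sum.cong refl) (auto simp: vec_upd_def algebra_simps)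
  also have "\<dots> = a \<bullet> u + a $ i * (v - u $ i)"
    by (simp add: sum.distrib inner_vec_def)
  finally show ?thesis .
qed

text \<open>Poisson weights satisfy w_m' = l (w_(m-1) - w_m) with w_(-1) = 0; the conditional
  carries this convention, since \<open>m - 1\<close> is truncated at 0.\<close>

lemma has_field_derivative_poisson:
  fixes y :: "real \<Rightarrow> real"
  assumes [derivative_intros]: "(y has_field_derivative l) (at v)"
  shows "((\<lambda>v. y v ^ m / fact m * exp (- y v)) has_field_derivative
    l * ((if m = 0 then 0 else y v ^ (m - 1) / fact (m - 1) * exp (- y v)) -
      y v ^ m / fact m * exp (- y v))) (at v)"
proof (cases m)
  case 0
  show ?thesis unfolding 0 by (auto intro!: derivative_eq_intros)
next
  case (Suc n)
  have "((\<lambda>v. y v ^ Suc n / fact (Suc n)) has_field_derivative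
      real (Suc n) * (l * y v ^ n) / fact (Suc n)) (at v)"
    by (rule DERIV_cong[OF DERIV_cdivide[OF DERIV_power[OF assms, of "Suc n"]]]) simp
  also have "real (Suc n) * (l * y v ^ n) / fact (Suc n) = l * (y v ^ n / fact n)"
    unfolding fact_Suc by (simp del: of_nat_Suc)
  finally have [derivative_intros]: "((\<lambda>v. y v ^ m / fact m) has_field_derivative
      l * (y v ^ n / fact n)) (at v)"
    unfolding Suc .
  show ?thesis
    by (rule derivative_eq_intros refl assms)+ (simp add: Suc algebra_simps del: power_Suc fact_Suc)
qed

text \<open>Each term of the product rule differentiates one Poisson weight, of index
  \<open>j\<close>, and leaves the others alone. Summed over \<open>Omega k n\<close>, the unchanged
  weights reproduce level \<open>n\<close> and the lowered ones give level
  \<open>n - j\<close>.\<close>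

lemma has_field_derivative_gcp_pmf:
  "((\<lambda>v. gcp_pmf k \<Lambda> n (vec_upd u i v)) has_field_derivative
    - (\<Sum>j = 1..k. \<Lambda> j $ i * (gcp_pmf k \<Lambda> n (vec_upd u i v) -
      (if j \<le> n then gcp_pmf k \<Lambda> (n - j) (vec_upd u i v) else 0)))) (at v)"
proof -
  define y where "y j v = \<Lambda> j \<bullet> vec_upd u i v" for j v
  define w where "w m j = y j v ^ m / fact m * exp (- y j v)" for m j
  define dw where "dw m j = \<Lambda> j $ i * ((if m = 0 then 0 else w (m - 1) j) - w m j)" for m j
  have y: "(y j has_field_derivative \<Lambda> j $ i) (at v)" for j
    unfolding y_def inner_vec_upd by (auto intro!: derivative_eq_intros)
  have prod: "((\<lambda>v. \<Prod>j = 1..k. y j v ^ x j / fact (x j) * exp (- y j v)) has_field_derivative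
      (\<Sum>j = 1..k. dw (x j) j * (\<Prod>l\<in>{1..k} - {j}. w (x l) l))) (at v)" for x
    unfolding w_def dw_def by (rule has_field_derivative_prod) (rule has_field_derivative_poisson[OF y])
  have "((\<lambda>v. gcp_pmf k \<Lambda> n (vec_upd u i v)) has_field_derivative
      (\<Sum>x\<in>Omega k n. \<Sum>j = 1..k. dw (x j) j * (\<Prod>l\<in>{1..k} - {j}. w (x l) l))) (at v)"
    unfolding gcp_pmf_def y_def[symmetric] by (rule DERIV_sum) (rule prod)
  also have "(\<Sum>x\<in>Omega k n. \<Sum>j = 1..k. dw (x j) j * (\<Prod>l\<in>{1..k} - {j}. w (x l) l)) =
      (\<Sum>j = 1..k. \<Sum>x\<in>Omega k n. dw (x j) j * (\<Prod>l\<in>{1..k} - {j}. w (x l) l))"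
    by (rule sum.swap)
  also have "\<dots> = (\<Sum>j = 1..k. - (\<Lambda> j $ i * (gcp_pmf k \<Lambda> n (vec_upd u i v) -
      (if j \<le> n then gcp_pmf k \<Lambda> (n - j) (vec_upd u i v) else 0))))"
  proof (rule sum.cong[OF refl])
    fix j assume j: "j \<in> {1..k}"
    have full: "(\<Prod>l = 1..k. w (x l) l) = w (x j) j * (\<Prod>l\<in>{1..k} - {j}. w (x l) l)" for x
      using j by (subst prod.remove[of _ j]) auto
    have upd: "(\<Prod>l = 1..k. w ((x(j := m)) l) l) = w m j * (\<Prod>l\<in>{1..k} - {j}. w (x l) l)" for x m
      using j by (subst prod.remove[of _ j]) (auto intro!: prod.cong)
    have "(\<Sum>x\<in>Omega k n. dw (x j) j * (\<Prod>l\<in>{1..k} - {j}. w (x l) l)) =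
        \<Lambda> j $ i * ((\<Sum>x\<in>Omega k n. if x j = 0 then 0 else (\<Prod>l = 1..k. w ((x(j := x j - 1)) l) l)) -
          (\<Sum>x\<in>Omega k n. \<Prod>l = 1..k. w (x l) l))"
      unfolding upd full sum_subtractf[symmetric] sum_distrib_left
      by (intro sum.cong refl) (auto simp: dw_def algebra_simps)
    also have "(\<Sum>x\<in>Omega k n. if x j = 0 then 0 else (\<Prod>l = 1..k. w ((x(j := x j - 1)) l) l)) =
        (if j \<le> n then \<Sum>x\<in>Omega k (n - j). \<Prod>l = 1..k. w (x l) l else 0)"
      by (rule sum_Omega_shift[OF j])
    finally show "(\<Sum>x\<in>Omega k n. dw (x j) j * (\<Prod>l\<in>{1..k} - {j}. w (x l) l)) =
        - (\<Lambda> j $ i * (gcp_pmf k \<Lambda> n (vec_upd u i v) -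
          (if j \<le> n then gcp_pmf k \<Lambda> (n - j) (vec_upd u i v) else 0)))"
      by (simp add: gcp_pmf_def w_def y_def algebra_simps)
  qed
  finally show ?thesis by (simp add: sum_negf)
qed

section \<open>Caputo derivatives of Mittag-Leffler type series\<close>

lemma Gamma_plus1_pos:
  fixes x :: real
  assumes "0 < x"
  shows "Gamma (x + 1) = x * Gamma x"
  using assms by (intro Gamma_plus1) (auto dest: nonpos_Ints_nonpos)

text \<open>Log-convexity of Gamma at \<open>x\<close>, seen between \<open>x - 1\<close> and
  \<open>x + \<alpha>\<close>, combined with Gamma(x) = (x - 1) Gamma(x - 1). Thus consecutive
  denominators of a Mittag-Leffler series grow by an unbounded factor.\<close>

lemma Gamma_add_ge:
  fixes x \<alpha> :: real
  assumes \<alpha>: "0 < \<alpha>" and x: "1 < x"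
  shows "(x - 1) powr \<alpha> * Gamma x \<le> Gamma (x + \<alpha>)"
proof -
  have pos: "0 < Gamma (x - 1)" "0 < Gamma x" "0 < Gamma (x + \<alpha>)"
    using assms by (auto intro: Gamma_real_pos)
  \<comment> \<open>The weight for which the convex combination of \<open>x - 1\<close> and
    \<open>x + \<alpha>\<close> equals \<open>x\<close>.\<close>
  define \<theta> where "\<theta> = 1 / (1 + \<alpha>)"
  have \<theta>: "0 \<le> \<theta>" "\<theta> \<le> 1" "\<theta> * (1 + \<alpha>) = 1"
    using \<alpha> by (auto simp: \<theta>_def field_simps)
  have "(ln \<circ> Gamma) ((1 - \<theta>) *\<^sub>R (x - 1) + \<theta> *\<^sub>R (x + \<alpha>)) \<le>
      (1 - \<theta>) * (ln \<circ> Gamma) (x - 1) + \<theta> * (ln \<circ> Gamma) (x + \<alpha>)"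
    using assms \<theta> by (intro convex_onD[OF log_convex_Gamma_real]) auto
  moreover have "(1 - \<theta>) *\<^sub>R (x - 1) + \<theta> *\<^sub>R (x + \<alpha>) = x"
    using \<theta>(3) by (simp add: algebra_simps)
  moreover have "ln (Gamma (x - 1)) = ln (Gamma x) - ln (x - 1)"
    using Gamma_plus1_pos[of "x - 1"] x pos(1) ln_mult_pos[of "x - 1" "Gamma (x - 1)"] by simp
  ultimately have "ln (Gamma x) \<le> (1 - \<theta>) * (ln (Gamma x) - ln (x - 1)) + \<theta> * ln (Gamma (x + \<alpha>))"
    by simp
  then have "(1 + \<alpha>) * ln (Gamma x) \<le>
      (1 + \<alpha>) * ((1 - \<theta>) * (ln (Gamma x) - ln (x - 1)) + \<theta> * ln (Gamma (x + \<alpha>)))"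
    using \<alpha> by (intro mult_left_mono) auto
  also have "\<dots> = \<alpha> * (ln (Gamma x) - ln (x - 1)) + ln (Gamma (x + \<alpha>))"
    using \<theta>(3) by algebra
  finally have "\<alpha> * ln (x - 1) + ln (Gamma x) \<le> ln (Gamma (x + \<alpha>))"
    by (simp add: algebra_simps)
  then have "exp (\<alpha> * ln (x - 1) + ln (Gamma x)) \<le> Gamma (x + \<alpha>)"
    using pos by (metis exp_ln exp_le_cancel_iff)
  then show ?thesis
    using x pos by (simp add: exp_add powr_def)
qed

lemma summable_mittag_leffler:
  fixes \<alpha> y :: real
  assumes \<alpha>: "0 < \<alpha>"
  shows "summable (\<lambda>r. y ^ r / Gamma (\<alpha> * real r + 1))"
proof -
  have "filterlim (\<lambda>r. (\<alpha> * real r) powr \<alpha>) at_top sequentially"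
    using \<alpha> by real_asymp
  then have "eventually (\<lambda>r. 2 * \<bar>y\<bar> \<le> (\<alpha> * real r) powr \<alpha>) sequentially"
    by (simp add: filterlim_at_top)
  then obtain n0 where n0: "\<And>r. r \<ge> n0 \<Longrightarrow> 2 * \<bar>y\<bar> \<le> (\<alpha> * real r) powr \<alpha>"
    by (auto simp: eventually_sequentially)
  show ?thesis
  \<comment> \<open>From \<open>n0\<close> on the denominators grow at least by the factor
    \<open>2 * \<bar>y\<bar>\<close>, hence the ratio 1/2. The bound \<open>1 \<le> r\<close> puts
    the argument \<open>\<alpha> * real r + 1\<close> above 1, as \<open>Gamma_add_ge\<close>
    requires.\<close>
  proof (rule summable_ratio_test[where c = "1 / 2" and N = "max n0 1"])
    fix r assume r: "max n0 1 \<le> r"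
    define a b where "a = Gamma (\<alpha> * real r + 1)" and "b = Gamma (\<alpha> * real (Suc r) + 1)"
    have pos: "0 < a" "0 < b" using \<alpha> by (auto simp: a_def b_def intro!: Gamma_real_pos add_nonneg_pos)
    have "2 * \<bar>y\<bar> * a \<le> (\<alpha> * real r) powr \<alpha> * a"
      using n0 r pos by (intro mult_right_mono) auto
    also have "\<dots> \<le> b"
      using Gamma_add_ge[of \<alpha> "\<alpha> * real r + 1"] \<alpha> r by (simp add: a_def b_def algebra_simps)
    finally have "\<bar>y\<bar> ^ r * (2 * \<bar>y\<bar> * a) \<le> \<bar>y\<bar> ^ r * b"
      by (intro mult_left_mono) auto
    then have "norm (y ^ Suc r / b) \<le> 1 / 2 * norm (y ^ r / a)"
      using pos by (simp add: abs_mult power_abs field_simps)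
    then show "norm (y ^ Suc r / Gamma (\<alpha> * real (Suc r) + 1)) \<le>
        1 / 2 * norm (y ^ r / Gamma (\<alpha> * real r + 1))"
      by (simp add: a_def b_def)
  qed simp
qed

lemma Gamma_mult_add_one_pos: "0 < \<alpha> \<Longrightarrow> 0 < Gamma (\<alpha> * real r + 1)"
  by (intro Gamma_real_pos add_nonneg_pos) auto

text \<open>Geometric growth is absorbed by rescaling the argument to
  \<open>K * \<bar>y\<bar>\<close>. The bound survives index shifts and finite linear combinations
  with a common \<open>K\<close>, which is why later series are controlled through it.\<close>

lemma summable_mittag_leffler_coeff:
  fixes \<alpha> C K y :: real
  assumes \<alpha>: "0 < \<alpha>" and b: "\<And>r. \<bar>b r\<bar> \<le> C * K ^ r"
  shows "summable (\<lambda>r. norm (b r / Gamma (\<alpha> * real r + 1) * y ^ r))"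
proof (rule summable_comparison_test')
  show "summable (\<lambda>r. C * ((K * \<bar>y\<bar>) ^ r / Gamma (\<alpha> * real r + 1)))"
    by (intro summable_mult summable_mittag_leffler \<alpha>)
  fix r :: nat
  have "\<bar>b r\<bar> * (\<bar>y\<bar> ^ r / Gamma (\<alpha> * real r + 1)) \<le> C * K ^ r * (\<bar>y\<bar> ^ r / Gamma (\<alpha> * real r + 1))"
    using b Gamma_mult_add_one_pos[OF \<alpha>, of r] by (intro mult_right_mono) auto
  then show "norm (norm (b r / Gamma (\<alpha> * real r + 1) * y ^ r)) \<le>
      C * ((K * \<bar>y\<bar>) ^ r / Gamma (\<alpha> * real r + 1))"
    using Gamma_mult_add_one_pos[OF \<alpha>, of r]
    by (simp add: abs_mult power_abs power_mult_distrib field_simps)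
qed

section \<open>Termwise Caputo differentiation of power series in
  \<open>s powr \<alpha>\<close>\<close>

lemma powr_power_mult:
  fixes s \<alpha> :: real
  assumes "0 < s"
  shows "(s powr \<alpha>) ^ r = s powr (\<alpha> * real r)"
  using assms by (simp add: powr_powr flip: powr_realpow)

text \<open>The substitution s = t x reduces this to the Beta integral on the unit interval.
  Computing the nonnegative integral yields integrability together with the value, also where the
  integrand is unbounded near an endpoint.\<close>

lemma has_bochner_integral_Beta:
  fixes p q t :: real
  assumes p: "0 < p" and q: "0 < q" and t: "0 < t"
  shows "has_bochner_integral lborel
    (\<lambda>s. indicator {0<..<t} s * ((t - s) powr (p - 1) * s powr (q - 1))) (t powr (p + q - 1) * Beta p q)"
proof -
  define f where "f s = indicator {0<..<t} s * ((t - s) powr (p - 1) * s powr (q - 1))" for s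
  have [measurable]: "f \<in> borel_measurable borel" unfolding f_def by measurable
  have "((\<lambda>x. x powr (q - 1) * (1 - x) powr (p - 1)) has_integral Beta q p) {0<..<1}"
    using has_integral_Beta_real[OF q p] by (simp add: has_integral_Icc_iff_Ioo)
  then have "(\<integral>\<^sup>+x. ennreal (x powr (q - 1) * (1 - x) powr (p - 1)) * indicator {0<..<1} x \<partial>lborel) = Beta q p"
    by (intro nn_integral_has_integral_lebesgue') auto
  moreover have "ennreal (f (0 + t * x)) =
      ennreal (t powr (p + q - 2)) * (ennreal (x powr (q - 1) * (1 - x) powr (p - 1)) * indicator {0<..<1} x)"
    for x
  proof (cases "x \<in> {0<..<1}")
    case True
    have "t - t * x = t * (1 - x)" by (simp add: algebra_simps)
    then have "(t - t * x) powr (p - 1) * (t * x) powr (q - 1) =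
        (t powr (p - 1) * t powr (q - 1)) * (x powr (q - 1) * (1 - x) powr (p - 1))"
      using True t by (simp add: powr_mult)
    also have "t powr (p - 1) * t powr (q - 1) = t powr (p + q - 2)"
      by (simp add: powr_add[symmetric] algebra_simps)
    finally show ?thesis
      using True t by (simp add: f_def ennreal_mult')
  next
    case False
    then have "t * x \<notin> {0<..<t}" using t by (auto simp: zero_less_mult_iff)
    then have "f (0 + t * x) = 0" by (simp add: f_def)
    with False show ?thesis by simp
  qed
  ultimately have "(\<integral>\<^sup>+s. f s \<partial>lborel) = ennreal t * (ennreal (t powr (p + q - 2)) * ennreal (Beta q p))"
    using t by (subst nn_integral_real_affine[where c = t and t = 0]) (simp_all add: nn_integral_cmult)
  also have "\<dots> = ennreal (t * t powr (p + q - 2) * Beta q p)"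
    using t by (simp add: ennreal_mult' mult.assoc)
  also have "t * t powr (p + q - 2) * Beta q p = t powr (p + q - 1) * Beta p q"
    using t by (simp add: powr_mult_base Beta_commute algebra_simps)
  finally have "(\<integral>\<^sup>+s. f s \<partial>lborel) = ennreal (t powr (p + q - 1) * Beta p q)" .
  then have "has_bochner_integral lborel f (t powr (p + q - 1) * Beta p q)"
    using p q by (intro has_bochner_integral_nn_integral)
      (auto simp: f_def Beta_def intro!: mult_nonneg_nonneg divide_nonneg_nonneg less_imp_le[OF Gamma_real_pos])
  then show ?thesis by (simp add: f_def[abs_def])
qed

text \<open>The term of index r + 1 has derivative b(r+1) s^(\<alpha>(r+1)-1) /
  Gamma(\<alpha>(r+1)); its Beta integral against (t - s)^(-\<alpha>) is Gamma(1 - \<alpha>) b(r+1)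
  (t^\<alpha>)^r / Gamma(\<alpha> r + 1). The constant term drops out, whence the index shift. The
  integrals of the absolute terms are again summable, which permits the interchange.\<close>

lemma caputo_power_series:
  fixes \<alpha> t C K :: real
  assumes \<alpha>: "0 < \<alpha>" "\<alpha> < 1" and t: "0 < t"
    and b: "\<And>r. \<bar>b r\<bar> \<le> C * K ^ r"
    and f: "\<And>s. 0 < s \<Longrightarrow> f s = (\<Sum>r. b r / Gamma (\<alpha> * real r + 1) * (s powr \<alpha>) ^ r)"
  shows "caputo_differentiable \<alpha> f t"
    and "caputo_deriv \<alpha> f t = (\<Sum>r. b (Suc r) / Gamma (\<alpha> * real r + 1) * (t powr \<alpha>) ^ r)"
proof -
  define c where "c r = b r / Gamma (\<alpha> * real r + 1)" for r
  define g where "g r s = b (Suc r) / Gamma (\<alpha> * real (Suc r)) * s powr (\<alpha> * real (Suc r) - 1)" for r s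
  have Gpos: "0 < Gamma (\<alpha> * real r + 1)" "0 < Gamma (\<alpha> * real (Suc r))" for r
    using \<alpha> by (auto intro!: Gamma_real_pos add_nonneg_pos)
  \<comment> \<open>The chain rule through y = \<open>s powr \<alpha>\<close> makes
    \<open>g r s\<close> the derivative of the term of index \<open>Suc r\<close>. The version with
    absolute coefficients gives absolute convergence, the remaining factors being
    nonnegative.\<close>
  have g_eq: "diffs c r * (s powr \<alpha>) ^ r * (\<alpha> * s powr (\<alpha> - 1)) = g r s"
    and g_abs_eq: "diffs (\<lambda>r. \<bar>c r\<bar>) r * (s powr \<alpha>) ^ r * (\<alpha> * s powr (\<alpha> - 1)) = \<bar>g r s\<bar>"
    if s: "0 < s" for r s
  proof -
    have "Gamma (\<alpha> * real (Suc r) + 1) = \<alpha> * real (Suc r) * Gamma (\<alpha> * real (Suc r))"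
      using \<alpha> by (intro Gamma_plus1_pos) auto
    then have "real (Suc r) * c (Suc r) * \<alpha> = b (Suc r) / Gamma (\<alpha> * real (Suc r))"
      using \<alpha> by (simp add: c_def field_simps del: of_nat_Suc)
    moreover have "(s powr \<alpha>) ^ r * s powr (\<alpha> - 1) = s powr (\<alpha> * real (Suc r) - 1)"
      using s by (simp add: powr_power_mult powr_add[symmetric] algebra_simps)
    moreover have "diffs c r * (s powr \<alpha>) ^ r * (\<alpha> * s powr (\<alpha> - 1)) =
        (real (Suc r) * c (Suc r) * \<alpha>) * ((s powr \<alpha>) ^ r * s powr (\<alpha> - 1))"
      by (simp add: diffs_def)
    ultimately show 1: "diffs c r * (s powr \<alpha>) ^ r * (\<alpha> * s powr (\<alpha> - 1)) = g r s"
      by (simp add: g_def)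
    have "diffs (\<lambda>r. \<bar>c r\<bar>) r * (s powr \<alpha>) ^ r * (\<alpha> * s powr (\<alpha> - 1)) =
        \<bar>diffs c r * (s powr \<alpha>) ^ r * (\<alpha> * s powr (\<alpha> - 1))\<bar>"
      using \<alpha> by (simp add: diffs_def abs_mult del: of_nat_Suc)
    with 1 show "diffs (\<lambda>r. \<bar>c r\<bar>) r * (s powr \<alpha>) ^ r * (\<alpha> * s powr (\<alpha> - 1)) = \<bar>g r s\<bar>"
      by simp
  qed
  have sum_c: "summable (\<lambda>r. norm (c r * y ^ r))" for y
    unfolding c_def by (rule summable_mittag_leffler_coeff[OF \<alpha>(1) b])
  then have sum_c': "summable (\<lambda>r. c r * y ^ r)" "summable (\<lambda>r. \<bar>c r\<bar> * y ^ r)" for y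
    by (auto intro: summable_norm_cancel intro!: summable_norm_cancel[of "\<lambda>r. \<bar>c r\<bar> * y ^ r"]
        simp: abs_mult)
  have sum_g: "summable (\<lambda>r. norm (g r s))" if "0 < s" for s
    using summable_mult2[OF termdiff_converges_all[OF sum_c'(2)], of "s powr \<alpha>" "\<alpha> * s powr (\<alpha> - 1)"]
    by (simp add: g_abs_eq[OF that])
  have deriv: "(f has_field_derivative (\<Sum>r. g r s)) (at s)" if s: "0 < s" for s
  proof -
    have "((\<lambda>s. \<Sum>r. c r * (s powr \<alpha>) ^ r) has_field_derivative
        (\<Sum>r. diffs c r * (s powr \<alpha>) ^ r) * (\<alpha> * s powr (\<alpha> - 1))) (at s)"
      by (rule DERIV_chain2[OF termdiffs_strong_converges_everywhere has_real_derivative_powr])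
        (use sum_c' s in auto)
    also have "(\<Sum>r. diffs c r * (s powr \<alpha>) ^ r) * (\<alpha> * s powr (\<alpha> - 1)) = (\<Sum>r. g r s)"
      by (subst suminf_mult2) (use termdiff_converges_all[OF sum_c'(1)] g_eq[OF s] in auto)
    finally show ?thesis
      by (rule has_field_derivative_transform_within_open[of _ _ _ "{0<..}"])
        (use s f in \<open>auto simp: c_def\<close>)
  qed
  then have deriv_eq: "deriv f s = (\<Sum>r. g r s)" if "0 < s" for s
    using that by (intro DERIV_imp_deriv) auto
  define h where "h r s = indicator {0<..<t} s * ((t - s) powr (- \<alpha>) * g r s)" for r s
  \<comment> \<open>The Beta integral with p = 1 - \<alpha> and q = \<alpha>(r+1), so that p + q - 1
    = \<alpha> r.\<close>
  have B: "has_bochner_integral lborel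
      (\<lambda>s. indicator {0<..<t} s * ((t - s) powr (- \<alpha>) * s powr (\<alpha> * real (Suc r) - 1)))
      ((t powr \<alpha>) ^ r * (Gamma (1 - \<alpha>) * Gamma (\<alpha> * real (Suc r)) / Gamma (\<alpha> * real r + 1)))" for r
  proof -
    have *: "(1 - \<alpha>) + \<alpha> * real (Suc r) = \<alpha> * real r + 1"
      by (simp add: algebra_simps)
    show ?thesis
      using has_bochner_integral_Beta[of "1 - \<alpha>" "\<alpha> * real (Suc r)" t] \<alpha> t
      unfolding Beta_def * by (simp add: powr_power_mult[OF t] del: of_nat_Suc)
  qed
  have h_int: "has_bochner_integral lborel (h r)
      (Gamma (1 - \<alpha>) * (b (Suc r) / Gamma (\<alpha> * real r + 1) * (t powr \<alpha>) ^ r))" for r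
    using has_bochner_integral_mult_right[OF B[of r], of "b (Suc r) / Gamma (\<alpha> * real (Suc r))"] Gpos(2)[of r]
    by (simp add: h_def[abs_def] g_def mult_ac del: of_nat_Suc)
  have h_norm_int: "has_bochner_integral lborel (\<lambda>s. norm (h r s))
      (Gamma (1 - \<alpha>) * norm (b (Suc r) / Gamma (\<alpha> * real r + 1) * (t powr \<alpha>) ^ r))" for r
    using has_bochner_integral_mult_right[OF B[of r], of "\<bar>b (Suc r)\<bar> / Gamma (\<alpha> * real (Suc r))"]
      Gpos(1)[of r] Gpos(2)[of r]
    by (simp add: h_def[abs_def] g_def mult_ac abs_mult del: of_nat_Suc)
  \<comment> \<open>The shifted sequence is bounded by \<open>C * K * K ^ r\<close>, so the same
    criterion applies.\<close>
  have sum_shift: "summable (\<lambda>r. norm (b (Suc r) / Gamma (\<alpha> * real r + 1) * (t powr \<alpha>) ^ r))"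
    by (rule summable_mittag_leffler_coeff[of \<alpha> _ "C * K" K]) (use b[of "Suc r" for r] \<alpha> in \<open>auto simp: mult_ac\<close>)
  have h_suminf: "(\<Sum>r. h r s) = indicator {0<..<t} s * ((t - s) powr (- \<alpha>) * deriv f s)"
    and h_sum: "summable (\<lambda>r. norm (h r s))" for s
  proof -
    consider "s \<notin> {0<..<t}" | "s \<in> {0<..<t}" by blast
    then have "(\<Sum>r. h r s) = indicator {0<..<t} s * ((t - s) powr (- \<alpha>) * deriv f s) \<and>
        summable (\<lambda>r. norm (h r s))"
    proof cases
      case 2
      then show ?thesis
        using sum_g[of s] summable_norm_cancel[OF sum_g[of s]]
        by (auto simp: h_def deriv_eq suminf_mult abs_mult intro!: summable_mult)
    qed (simp add: h_def)
    then show "(\<Sum>r. h r s) = indicator {0<..<t} s * ((t - s) powr (- \<alpha>) * deriv f s)"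
      "summable (\<lambda>r. norm (h r s))" by auto
  qed
  have int: "integrable lborel (h r)" for r
    using h_int by (rule integrable.intros)
  have sum_norm_int: "summable (\<lambda>r. \<integral>s. norm (h r s) \<partial>lborel)"
    unfolding has_bochner_integral_integral_eq[OF h_norm_int] by (intro summable_mult sum_shift)
  have "integrable lborel (\<lambda>s. \<Sum>r. h r s)"
    by (rule integrable_suminf) (use int h_sum sum_norm_int in auto)
  moreover have "f differentiable (at s)" if "0 < s" for s
    using deriv[OF that] real_differentiable_def by blast
  ultimately show "caputo_differentiable \<alpha> f t"
    by (auto simp: caputo_differentiable_def set_integrable_def h_suminf)
  have "(\<integral>s. (\<Sum>r. h r s) \<partial>lborel) = (\<Sum>r. \<integral>s. h r s \<partial>lborel)"
    by (rule integral_suminf) (use int h_sum sum_norm_int in auto)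
  also have "\<dots> = Gamma (1 - \<alpha>) * (\<Sum>r. b (Suc r) / Gamma (\<alpha> * real r + 1) * (t powr \<alpha>) ^ r)"
    unfolding has_bochner_integral_integral_eq[OF h_int]
    by (intro suminf_mult summable_norm_cancel[OF sum_shift])
  finally show "caputo_deriv \<alpha> f t = (\<Sum>r. b (Suc r) / Gamma (\<alpha> * real r + 1) * (t powr \<alpha>) ^ r)"
    using \<alpha> less_imp_neq[OF Gamma_real_pos[of "1 - \<alpha>"]]
    by (simp add: caputo_deriv_def set_lebesgue_integral_def h_suminf)
qed

section \<open>Laplace transforms and Gamma integrals\<close>

text \<open>Right continuity of \<open>cdf M2\<close>, with \<open>y\<close> decreasing to
  \<open>x\<close>. Distribution functions may then be compared across a gap between thresholds, so
  that atoms at the threshold need no attention.\<close>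

lemma cdf_le_of_shifted:
  assumes "real_distribution M1" "real_distribution M2"
    and "\<And>x y. x < y \<Longrightarrow> cdf M1 x \<le> cdf M2 y"
  shows "cdf M1 x \<le> cdf M2 x"
proof -
  interpret M2: real_distribution M2 by fact
  have "(cdf M2 \<longlongrightarrow> cdf M2 x) (at_right x)"
    using M2.cdf_is_right_cont[of x] by (simp add: continuous_within)
  moreover have "eventually (\<lambda>y. cdf M1 x \<le> cdf M2 y) (at_right x)"
    using assms(3) by (auto simp: eventually_at_filter)
  ultimately show ?thesis
    by (rule tendsto_lowerbound) simp
qed

lemma real_distribution_eqI_shifted_cdf:
  assumes "real_distribution M1" "real_distribution M2"
    and "\<And>x y. x < y \<Longrightarrow> cdf M1 x \<le> cdf M2 y"
    and "\<And>x y. x < y \<Longrightarrow> cdf M2 x \<le> cdf M1 y"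
  shows "M1 = M2"
  using assms by (intro cdf_unique ext order.antisym cdf_le_of_shifted)

text \<open>Uniqueness in the Hausdorff moment problem. Moments determine the integrals of
  polynomials, which approximate a continuous step uniformly on the unit interval; the integral of a
  step falling from 1 at \<open>u\<close> to 0 at \<open>v\<close> lies between the distribution
  function at \<open>u\<close> and at \<open>v\<close>.\<close>

lemma real_distribution_eqI_moments:
  assumes M1: "real_distribution M1" and M2: "real_distribution M2"
    and AE: "AE x in M1. x \<in> {0..1}" "AE x in M2. x \<in> {0..1}"
    and moments: "\<And>n. (\<integral>x. x ^ n \<partial>M1) = (\<integral>x. x ^ n \<partial>M2)"
  shows "M1 = M2"
proof -
  interpret M1: real_distribution M1 by fact
  interpret M2: real_distribution M2 by fact
  have int_pow: "integrable M (\<lambda>x. x ^ n)"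
    if "real_distribution M" "AE x in M. x \<in> {0..1}" for M and n :: nat
  proof -
    interpret real_distribution M by fact
    show ?thesis
      using that(2) by (intro integrable_const_bound[of _ 1]) (auto simp: power_le_one)
  qed
  have int_poly: "integrable M (\<lambda>x. \<Sum>i\<le>n. a i * x ^ i)"
    "(\<integral>x. (\<Sum>i\<le>n. a i * x ^ i) \<partial>M) = (\<Sum>i\<le>n. a i * (\<integral>x. x ^ i \<partial>M))"
    if "real_distribution M" "AE x in M. x \<in> {0..1}" for M and n :: nat and a
    using int_pow[OF that] by auto
  have step: "(\<integral>x. cts_step u v x \<partial>M1) = (\<integral>x. cts_step u v x \<partial>M2)" if uv: "u < v" for u v
  proof -
    \<comment> \<open>One \<open>e\<close> for the polynomial approximation under each of the two
      measures.\<close>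
    have dist_le: "\<bar>(\<integral>x. cts_step u v x \<partial>M1) - (\<integral>x. cts_step u v x \<partial>M2)\<bar> \<le> 2 * e" if e: "0 < e" for e
    proof -
      have "continuous_on {0..1} (cts_step u v)"
        using uniformly_continuous_imp_continuous[OF cts_step_uniformly_continuous[OF uv]]
        by (rule continuous_on_subset) simp
      then obtain g where g: "real_polynomial_function g"
          "\<And>x. x \<in> {0..1} \<Longrightarrow> \<bar>cts_step u v x - g x\<bar> < e"
        using Stone_Weierstrass_real_polynomial_function[of "{0..1::real}" "cts_step u v" e] e by auto
      then obtain a n where a: "g = (\<lambda>x. \<Sum>i\<le>n. a i * x ^ i)"
        using real_polynomial_function_iff_sum by auto
      have approx: "\<bar>(\<integral>x. cts_step u v x \<partial>M) - (\<integral>x. g x \<partial>M)\<bar> \<le> e"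
        if M: "real_distribution M" "AE x in M. x \<in> {0..1}" for M
      proof -
        interpret real_distribution M by fact
        have int: "integrable M (cts_step u v)" "integrable M g"
          using integrable_cts_step[OF uv] int_poly(1)[OF M] by (auto simp: a)
        have "\<bar>(\<integral>x. cts_step u v x \<partial>M) - (\<integral>x. g x \<partial>M)\<bar> = \<bar>\<integral>x. cts_step u v x - g x \<partial>M\<bar>"
          using int by simp
        also have "\<dots> \<le> (\<integral>x. \<bar>cts_step u v x - g x\<bar> \<partial>M)"
          by (rule integral_abs_bound)
        also have "\<dots> \<le> (\<integral>x. e \<partial>M)"
          using M(2) g(2) int by (intro integral_mono_AE) (auto intro: less_imp_le)
        finally show ?thesis using prob_space by simp
      qed
      have "(\<integral>x. g x \<partial>M1) = (\<integral>x. g x \<partial>M2)"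
        unfolding a using int_poly(2)[OF M1 AE(1)] int_poly(2)[OF M2 AE(2)] moments by simp
      with approx[OF M1 AE(1)] approx[OF M2 AE(2)] show ?thesis by linarith
    qed
    have "\<bar>(\<integral>x. cts_step u v x \<partial>M1) - (\<integral>x. cts_step u v x \<partial>M2)\<bar> \<le> 0"
    proof (rule field_le_epsilon)
      fix e :: real assume "0 < e"
      with dist_le[of "e / 2"]
      show "\<bar>(\<integral>x. cts_step u v x \<partial>M1) - (\<integral>x. cts_step u v x \<partial>M2)\<bar> \<le> 0 + e" by simp
    qed
    then show ?thesis by simp
  qed
  show ?thesis
  proof (rule real_distribution_eqI_shifted_cdf[OF M1 M2])
    fix x y :: real assume xy: "x < y"
    show "cdf M1 x \<le> cdf M2 y" "cdf M2 x \<le> cdf M1 y"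
      using M1.cdf_cts_step[OF xy] M2.cdf_cts_step[OF xy] step[OF xy] by auto
  qed
qed

text \<open>The image under x -> exp(-x) lives on the unit interval, and its \<open>n\<close>-th
  moment is the Laplace transform at \<open>n\<close>. The map -ln carries the equality of the
  images back.\<close>

lemma real_distribution_eqI_laplace:
  assumes M1: "real_distribution M1" and M2: "real_distribution M2"
    and AE: "AE x in M1. 0 \<le> x" "AE x in M2. 0 \<le> x"
    and laplace: "\<And>w. 0 < w \<Longrightarrow> (\<integral>x. exp (- w * x) \<partial>M1) = (\<integral>x. exp (- w * x) \<partial>M2)"
  shows "M1 = M2"
proof -
  interpret M1: real_distribution M1 by fact
  interpret M2: real_distribution M2 by fact
  let ?E = "\<lambda>M. distr M borel (\<lambda>x::real. exp (- x))"
  have "?E M1 = ?E M2"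
  proof (rule real_distribution_eqI_moments)
    show "real_distribution (?E M1)" by (rule M1.real_distribution_distr) simp
    show "real_distribution (?E M2)" by (rule M2.real_distribution_distr) simp
    show "AE x in ?E M1. x \<in> {0..1}" "AE x in ?E M2. x \<in> {0..1}"
      using AE by (auto simp: AE_distr_iff)
    fix n :: nat
    \<comment> \<open>The moment of order 0 is the total mass; it is treated apart because the
      transforms are compared at positive arguments only.\<close>
    have "(\<integral>x. exp (- x) ^ n \<partial>M1) = (\<integral>x. exp (- x) ^ n \<partial>M2)"
      using laplace[of n] M1.prob_space M2.prob_space
      by (cases "n = 0") (simp_all add: exp_of_nat_mult[symmetric])
    then show "(\<integral>x. x ^ n \<partial>?E M1) = (\<integral>x. x ^ n \<partial>?E M2)"
      by (simp add: integral_distr)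
  qed
  then have "distr (?E M1) borel (\<lambda>y. - ln y) = distr (?E M2) borel (\<lambda>y. - ln y)" by simp
  then show ?thesis
    by (simp add: distr_distr o_def distr_id2)
qed

text \<open>Scaling in the Gamma integral. It writes \<open>x powr (- s)\<close> as a mixture of
  exponentials \<open>exp (- w * x)\<close>, so that negative moments become integrals of a Laplace
  transform.\<close>

lemma nn_integral_Gamma_scaled:
  fixes s x :: real
  assumes s: "0 < s" and x: "0 < x"
  shows "(\<integral>\<^sup>+w. ennreal (indicator {0<..} w * (w powr (s - 1) * exp (- w * x))) \<partial>lborel) =
    ennreal (Gamma s * x powr (- s))"
proof -
  have "((\<lambda>t. t powr (s - 1) / exp t) has_integral Gamma s) {0..}"
    by (rule Gamma_integral_real[OF s])
  then have "(\<integral>\<^sup>+w. ennreal (indicator {0..} w * (w powr (s - 1) / exp w)) \<partial>lborel) = Gamma s"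
    by (intro nn_integral_has_integral_lebesgue) auto
  also have "(\<integral>\<^sup>+w. ennreal (indicator {0..} w * (w powr (s - 1) / exp w)) \<partial>lborel) =
      ennreal x * (\<integral>\<^sup>+w. ennreal (indicator {0..} (0 + x * w) * ((0 + x * w) powr (s - 1) / exp (0 + x * w))) \<partial>lborel)"
    using x by (subst nn_integral_real_affine[where c = x and t = 0]) auto
  also have "\<dots> = ennreal x * (\<integral>\<^sup>+w. ennreal (x powr (s - 1)) *
      ennreal (indicator {0<..} w * (w powr (s - 1) * exp (- w * x))) \<partial>lborel)"
  proof (intro arg_cong2[where f = "(*)"] nn_integral_cong refl)
    fix w :: real
    \<comment> \<open>The two indicators differ at \<open>w = 0\<close> only, where
      \<open>0 powr (s - 1)\<close> is 0 whatever the exponent.\<close>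
    have "indicator {0..} (0 + x * w) * ((0 + x * w) powr (s - 1) / exp (0 + x * w)) =
        x powr (s - 1) * (indicator {0<..} w * (w powr (s - 1) * exp (- w * x)))"
      using x by (cases "w = 0")
        (auto simp: indicator_def zero_le_mult_iff powr_mult exp_minus field_simps)
    then show "ennreal (indicator {0..} (0 + x * w) * ((0 + x * w) powr (s - 1) / exp (0 + x * w))) =
        ennreal (x powr (s - 1)) * ennreal (indicator {0<..} w * (w powr (s - 1) * exp (- w * x)))"
      by (simp add: ennreal_mult')
  qed
  also have "\<dots> = ennreal (x powr s) *
      (\<integral>\<^sup>+w. ennreal (indicator {0<..} w * (w powr (s - 1) * exp (- w * x))) \<partial>lborel)"
    using x by (subst nn_integral_cmult) (simp_all add: mult.assoc[symmetric] ennreal_mult'[symmetric] powr_mult_base)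
  finally have "ennreal (x powr - s) * ennreal (Gamma s) = ennreal (x powr - s) * (ennreal (x powr s) *
      (\<integral>\<^sup>+w. ennreal (indicator {0<..} w * (w powr (s - 1) * exp (- w * x))) \<partial>lborel))"
    by simp
  moreover have "ennreal (x powr - s) * ennreal (x powr s) = 1"
    using x by (simp add: ennreal_mult'[symmetric] powr_add[symmetric])
  moreover have "ennreal (x powr - s) * ennreal (Gamma s) = ennreal (Gamma s * x powr (- s))"
    by (subst mult.commute) (simp add: ennreal_mult'')
  ultimately show ?thesis
    by (simp only: mult.assoc[symmetric] mult_1_left)
qed

text \<open>The substitution w = y^(1/\<alpha>) leads to a Gamma integral with parameter s /
  \<alpha>. The factor exp(-w^\<alpha>) is the Laplace transform of a stable subordinator at time
  1.\<close>

lemma nn_integral_stretched_exp: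
  fixes s \<alpha> :: real
  assumes s: "0 < s" and \<alpha>: "0 < \<alpha>"
  shows "(\<integral>\<^sup>+w. ennreal (indicator {0<..} w * (w powr (s - 1) * exp (- (w powr \<alpha>)))) \<partial>lborel) =
    ennreal (Gamma (s / \<alpha>) / \<alpha>)"
proof -
  define f where "f w = w powr (s - 1) * exp (- (w powr \<alpha>))" for w
  define g where "g y = y powr (1 / \<alpha>)" for y
  define g' where "g' y = 1 / \<alpha> * y powr (1 / \<alpha> - 1)" for y
  have fg: "f (g y) * g' y = 1 / \<alpha> * (y powr (s / \<alpha> - 1) * exp (- y * 1))" if "0 < y" for y
  proof -
    have "f (g y) * g' y = 1 / \<alpha> * ((y powr (1 / \<alpha> * (s - 1)) * y powr (1 / \<alpha> - 1)) * exp (- y))"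
      using that \<alpha> by (simp add: f_def g_def g'_def powr_powr)
    also have "y powr (1 / \<alpha> * (s - 1)) * y powr (1 / \<alpha> - 1) = y powr (s / \<alpha> - 1)"
      unfolding powr_add[symmetric] by (simp add: algebra_simps diff_divide_distrib)
    finally show ?thesis by simp
  qed
  have "has_bochner_integral lborel
      (\<lambda>y. indicator {0<..} y * (y powr (s / \<alpha> - 1) * exp (- y * 1))) (Gamma (s / \<alpha>))"
    using nn_integral_Gamma_scaled[of "s / \<alpha>" 1] s \<alpha>
    by (intro has_bochner_integral_nn_integral) (auto intro!: less_imp_le[OF Gamma_real_pos])
  then have "has_bochner_integral lborel
      (\<lambda>y. 1 / \<alpha> * (indicator {0<..} y * (y powr (s / \<alpha> - 1) * exp (- y * 1)))) (1 / \<alpha> * Gamma (s / \<alpha>))"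
    by (rule has_bochner_integral_mult_right)
  moreover have "1 / \<alpha> * (indicator {0<..} y * (y powr (s / \<alpha> - 1) * exp (- y * 1))) =
      indicator {0<..} y *\<^sub>R (f (g y) * g' y)" for y
    using fg[of y] by (cases "0 < y") auto
  ultimately have int: "has_bochner_integral lborel (\<lambda>y. indicator {0<..} y *\<^sub>R (f (g y) * g' y)) (1 / \<alpha> * Gamma (s / \<alpha>))"
    by simp
  have ei: "einterval 0 \<infinity> = {0<..}" by (auto simp: einterval_def)
  have sub: "set_integrable lborel (einterval 0 \<infinity>) f"
    "(LBINT x=0..\<infinity>. f x) = (LBINT x=0..\<infinity>. (f (g x) * g' x))"
  proof -
    \<comment> \<open>The substitution rule works on an interval of extended reals, so the endpoints
      enter as limits of \<open>g\<close> at 0 and at infinity.\<close>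
    have A: "((ereal \<circ> g \<circ> real_of_ereal) \<longlongrightarrow> 0) (at_right 0)"
      unfolding zero_ereal_def ereal_tendsto_simps g_def
      using \<alpha> by real_asymp
    have B: "((ereal \<circ> g \<circ> real_of_ereal) \<longlongrightarrow> \<infinity>) (at_left \<infinity>)"
      unfolding ereal_tendsto_simps g_def using \<alpha> by real_asymp
    have C: "set_integrable lborel (einterval 0 \<infinity>) (\<lambda>x. f (g x) * g' x)"
      unfolding set_integrable_def ei using int by (rule integrable.intros)
    note subst = interval_integral_substitution_nonneg[of 0 "\<infinity>" g g' f 0 "\<infinity>"]
    have D: "DERIV g x :> g' x" "isCont f (g x)" "isCont g' x" if "0 < ereal x" for x
      using that \<alpha> unfolding f_def g_def g'_def
      by (auto intro!: continuous_intros derivative_eq_intros simp: field_simps)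
    show "set_integrable lborel (einterval 0 \<infinity>) f"
      "(LBINT x=0..\<infinity>. f x) = (LBINT x=0..\<infinity>. (f (g x) * g' x))"
      using subst A B C D \<alpha> by (auto simp: f_def g'_def)
  qed
  have "(LBINT x=0..\<infinity>. f x) = 1 / \<alpha> * Gamma (s / \<alpha>)"
    unfolding sub(2) using has_bochner_integral_integral_eq[OF int]
    by (simp add: interval_lebesgue_integral_def ei set_lebesgue_integral_def)
  with sub(1) have "has_bochner_integral lborel (\<lambda>w. indicator {0<..} w * f w) (1 / \<alpha> * Gamma (s / \<alpha>))"
    by (simp add: has_bochner_integral_iff interval_lebesgue_integral_def ei
        set_lebesgue_integral_def set_integrable_def)
  then have "(\<integral>\<^sup>+w. ennreal (indicator {0<..} w * f w) \<partial>lborel) = ennreal (1 / \<alpha> * Gamma (s / \<alpha>))"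
    by (subst nn_integral_eq_integral) (auto simp: has_bochner_integral_iff f_def)
  then show ?thesis by (simp add: f_def)
qed

section \<open>Moments of the inverse stable subordinator\<close>

text \<open>The \<open>r\<close>-th derivative at 0 of x^m exp(-c x), that is \<open>fact r\<close>
  times its Taylor coefficient; for \<open>r < m\<close> the binomial coefficient makes it 0.
  Expectation at an inverse stable time only replaces x^r / r! by (t^\<alpha>)^r / Gamma(\<alpha> r
  + 1).\<close>

definition ml_coeff :: "nat \<Rightarrow> real \<Rightarrow> nat \<Rightarrow> real"
  where "ml_coeff m c r = fact m * real (r choose m) * (- c) ^ (r - m)"

text \<open>Apart from \<open>fact m\<close>, the absolute value is one term of the binomial
  expansion of (1 + |c|)^r.\<close>

lemma ml_coeff_bound: "\<bar>ml_coeff m c r\<bar> \<le> fact m * (1 + \<bar>c\<bar>) ^ r"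
proof (cases "m \<le> r")
  case True
  have "real (r choose m) * \<bar>c\<bar> ^ (r - m) \<le> (\<Sum>i\<le>r. real (r choose i) * \<bar>c\<bar> ^ (r - i))"
    using True by (intro member_le_sum[of m "{..r}" "\<lambda>i. real (r choose i) * \<bar>c\<bar> ^ (r - i)"]) auto
  also have "\<dots> = (1 + \<bar>c\<bar>) ^ r"
    by (simp add: binomial_ring)
  finally show ?thesis
    by (simp add: ml_coeff_def abs_mult power_abs mult.assoc)
qed (simp add: ml_coeff_def not_le binomial_eq_0)

lemma ml_coeff_shift: "ml_coeff m c (j + m) = fact (j + m) / fact j * (- c) ^ j"
  by (simp add: ml_coeff_def binomial_fact[of m "j + m"])

lemma ml_coeff_exp_sums:
  "(\<lambda>r. ml_coeff m c r / fact r * x ^ r) sums (x ^ m * exp (- c * x))"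
proof -
  have "(\<lambda>j. x ^ m * ((- c * x) ^ j /\<^sub>R fact j)) sums (x ^ m * exp (- c * x))"
    by (intro sums_mult exp_converges)
  also have "(\<lambda>j. x ^ m * ((- c * x) ^ j /\<^sub>R fact j)) =
      (\<lambda>j. ml_coeff m c (j + m) / fact (j + m) * x ^ (j + m))"
    unfolding power_mult_distrib[of "- c" x] by (simp add: ml_coeff_shift power_add divide_simps mult_ac)
  \<comment> \<open>The coefficients below index \<open>m\<close> vanish, so the series may start at
    0.\<close>
  finally show ?thesis
    by (subst (asm) sums_zero_iff_shift) (auto simp: ml_coeff_def)
qed

text \<open>Index shift r = j + m. With upper parameter m + 1 the numerator Gamma(j + m + 1) = (j +
  m)! is the factorial in the shifted \<open>ml_coeff\<close>, and \<open>fact m\<close> cancels the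
  normalization 1 / Gamma(m + 1).\<close>

lemma mittag_leffler3_eq_suminf:
  assumes \<alpha>: "0 < \<alpha>"
  shows "fact m * z ^ m * mittag_leffler3 \<alpha> (\<alpha> * real m + 1) (real m + 1) (- z * c) =
    (\<Sum>r. ml_coeff m c r / Gamma (\<alpha> * real r + 1) * z ^ r)"
proof -
  let ?f = "\<lambda>r. ml_coeff m c r / Gamma (\<alpha> * real r + 1) * z ^ r"
  have Gf: "Gamma (real n + 1) = fact n" for n
    using Gamma_fact[of n, where 'a = real] by (simp add: add.commute)
  have sum: "summable ?f"
    by (rule summable_norm_cancel[OF summable_mittag_leffler_coeff[OF \<alpha> ml_coeff_bound]])
  then have f: "summable (\<lambda>j. ?f (j + m))" "(\<Sum>r. ?f r) = (\<Sum>j. ?f (j + m))"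
    using summable_ignore_initial_segment[OF sum, of m] suminf_split_initial_segment[OF sum, of m]
    by (simp_all add: ml_coeff_def binomial_eq_0)
  let ?g = "\<lambda>j. Gamma (real j + (real m + 1)) * (- z * c) ^ j / (fact j * Gamma (real j * \<alpha> + (\<alpha> * real m + 1)))"
  have fg: "?f (j + m) = z ^ m * ?g j" for j
  proof -
    have 1: "Gamma (real j + (real m + 1)) = fact (j + m)"
      using Gf[of "j + m"] by (simp add: add.assoc)
    have 2: "real j * \<alpha> + (\<alpha> * real m + 1) = \<alpha> * real (j + m) + 1"
      by (simp add: algebra_simps)
    have 3: "(- z * c) ^ j = (- c) ^ j * z ^ j"
      by (simp add: power_mult_distrib[symmetric] mult.commute)
    show ?thesis
      unfolding 1 2 3 by (simp add: ml_coeff_shift power_add mult_ac)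
  qed
  show ?thesis
  \<comment> \<open>Here \<open>z ^ m\<close> cannot be cancelled to obtain summability of
    \<open>?g\<close>, but both sides are 0. The case arises for \<open>t $ i = 0\<close>.\<close>
  proof (cases "z = 0 \<and> 0 < m")
    case True
    then have "z ^ m = 0" by simp
    then show ?thesis
      unfolding f(2) fg by (simp only: mult_zero_left mult_zero_right suminf_zero)
  next
    case False
    then have "z ^ m \<noteq> 0" by auto
    with f(1) have g: "summable ?g"
      unfolding fg by (simp only: summable_cmult_iff) simp
    have "fact m * z ^ m * mittag_leffler3 \<alpha> (\<alpha> * real m + 1) (real m + 1) (- z * c) =
        z ^ m * (\<Sum>j. ?g j)"
      by (simp add: mittag_leffler3_def Gf)
    also have "\<dots> = (\<Sum>r. ?f r)"
      unfolding f(2) fg by (rule suminf_mult[OF g, symmetric])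
    finally show ?thesis .
  qed
qed

text \<open>Differentiating x^m exp(-c x) shifts the sequence of its derivatives at 0, and the two
  terms are those of the product rule. On the coefficients this is Pascal's rule.\<close>

lemma ml_coeff_Suc:
  "ml_coeff m c (Suc r) = (if m = 0 then 0 else real m * ml_coeff (m - 1) c r) - c * ml_coeff m c r"
proof (cases m)
  case 0
  then show ?thesis by (simp add: ml_coeff_def)
next
  case (Suc m')
  \<comment> \<open>Splitting off a factor \<open>- c\<close> needs \<open>m' < r\<close>; otherwise
    the binomial coefficient is 0.\<close>
  have "real (r choose Suc m') * (- c) ^ (r - m') = real (r choose Suc m') * (- c * (- c) ^ (r - Suc m'))"
  proof (cases "m' < r")
    case True
    then have "r - m' = Suc (r - Suc m')" by simp
    then show ?thesis by (simp only: power_Suc)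
  qed (simp add: not_less binomial_eq_0)
  then show ?thesis
    unfolding Suc by (simp add: ml_coeff_def algebra_simps)
qed

section \<open>Stable subordinators and their inverses at a single time\<close>

context prob_space
begin

lemma subordinator_AE:
  assumes "subordinator D"
  shows "AE \<omega> in M. (\<forall>s\<ge>0. 0 \<le> D s \<omega>) \<and> (\<forall>s t. 0 \<le> s \<longrightarrow> s \<le> t \<longrightarrow> D s \<omega> \<le> D t \<omega>)"
proof -
  have "AE \<omega> in M. D 0 \<omega> = 0 \<and> (\<forall>s t. 0 \<le> s \<longrightarrow> s \<le> t \<longrightarrow> D s \<omega> \<le> D t \<omega>) \<and>
      (\<forall>t\<ge>0. continuous (at_right t) (\<lambda>u. D u \<omega>))"
    using assms by (simp add: subordinator_def)
  then show ?thesis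
  proof eventually_elim
    case (elim \<omega>)
    then show ?case by (metis order.refl)
  qed
qed

text \<open>Self-similarity: both Laplace transforms are exp(-u w^\<alpha>), because (w
  u^(1/\<alpha>))^\<alpha> = u w^\<alpha>.\<close>

lemma stable_subordinator_scaling:
  assumes D: "stable_subordinator \<alpha> D" and \<alpha>: "0 < \<alpha>" and u: "0 < u"
  shows "distr M borel (D u) = distr M borel (\<lambda>\<omega>. u powr (1 / \<alpha>) * D 1 \<omega>)"
proof (rule real_distribution_eqI_laplace)
  have sub: "subordinator D" using D by (simp add: stable_subordinator_def)
  then have [measurable]: "D u \<in> borel_measurable M" "D 1 \<in> borel_measurable M"
    using u by (auto simp: subordinator_def)
  show "real_distribution (distr M borel (D u))"
    "real_distribution (distr M borel (\<lambda>\<omega>. u powr (1 / \<alpha>) * D 1 \<omega>))"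
    by (auto intro!: real_distribution_distr)
  show "AE x in distr M borel (D u). 0 \<le> x"
    "AE x in distr M borel (\<lambda>\<omega>. u powr (1 / \<alpha>) * D 1 \<omega>). 0 \<le> x"
    using AE_mp[OF subordinator_AE[OF sub], of "\<lambda>\<omega>. 0 \<le> D u \<omega>"]
      AE_mp[OF subordinator_AE[OF sub], of "\<lambda>\<omega>. 0 \<le> u powr (1 / \<alpha>) * D 1 \<omega>"] u
    by (simp_all add: AE_distr_iff)
  fix w :: real assume w: "0 < w"
  have laplace: "expectation (\<lambda>\<omega>. exp (- w * D t \<omega>)) = exp (- t * w powr \<alpha>)" if "0 < w" "0 \<le> t" for w t
    using D that by (simp add: stable_subordinator_def)
  have "expectation (\<lambda>\<omega>. exp (- w * D u \<omega>)) =
      expectation (\<lambda>\<omega>. exp (- (w * u powr (1 / \<alpha>)) * D 1 \<omega>))"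
    using laplace[of w u] laplace[of "w * u powr (1 / \<alpha>)" 1] w u \<alpha>
    by (simp add: powr_mult powr_powr)
  then show "(\<integral>x. exp (- w * x) \<partial>distr M borel (D u)) =
      (\<integral>x. exp (- w * x) \<partial>distr M borel (\<lambda>\<omega>. u powr (1 / \<alpha>) * D 1 \<omega>))"
    by (simp add: integral_distr mult.assoc)
qed

text \<open>A nonintegrable function has integral 0 by convention, whereas the prescribed transform
  is positive.\<close>

lemma stable_subordinator_integrable:
  assumes D: "stable_subordinator \<alpha> D" and "0 \<le> u" "0 < w"
  shows "integrable M (\<lambda>\<omega>. exp (- w * D u \<omega>))"
proof -
  have "expectation (\<lambda>\<omega>. exp (- w * D u \<omega>)) \<noteq> 0"
    using assms by (simp add: stable_subordinator_def)
  then show ?thesis using not_integrable_integral_eq by blast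
qed

text \<open>Chernoff's bound. With \<open>t = 0\<close> and growing \<open>w\<close> it gives
  positivity of \<open>D 1\<close>; with \<open>w = 1\<close> and growing \<open>u\<close> it gives
  unboundedness of the paths.\<close>

lemma stable_subordinator_prob_le:
  assumes D: "stable_subordinator \<alpha> D" and u: "0 \<le> u" and w: "0 < w"
  shows "prob {\<omega> \<in> space M. D u \<omega> \<le> t} \<le> exp (w * t - u * w powr \<alpha>)"
proof -
  have [measurable]: "D u \<in> borel_measurable M"
    using D u by (auto simp: stable_subordinator_def subordinator_def)
  have "exp (- w * t) * prob {\<omega> \<in> space M. D u \<omega> \<le> t} =
      expectation (\<lambda>\<omega>. exp (- w * t) * indicator {\<omega> \<in> space M. D u \<omega> \<le> t} \<omega>)"
    by simp
  also have "\<dots> \<le> expectation (\<lambda>\<omega>. exp (- w * D u \<omega>))"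
    using w by (intro integral_mono stable_subordinator_integrable[OF D u w]
        integrable_mult_right integrable_real_indicator)
      (auto simp: indicator_def less_top[symmetric])
  also have "\<dots> = exp (- u * w powr \<alpha>)"
    using D u w by (simp add: stable_subordinator_def)
  finally show ?thesis
    by (simp add: exp_diff exp_minus field_simps)
qed

lemma stable_subordinator_AE_pos:
  assumes D: "stable_subordinator \<alpha> D" and \<alpha>: "0 < \<alpha>"
  shows "AE \<omega> in M. 0 < D 1 \<omega>"
proof -
  have [measurable]: "D 1 \<in> borel_measurable M"
    using D by (auto simp: stable_subordinator_def subordinator_def)
  have "((\<lambda>w. exp (w * 0 - 1 * w powr \<alpha>)) \<longlongrightarrow> 0) at_top"
    using \<alpha> by real_asymp
  moreover have "eventually (\<lambda>w. prob {\<omega> \<in> space M. D 1 \<omega> \<le> 0} \<le> exp (w * 0 - 1 * w powr \<alpha>)) at_top"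
    using eventually_gt_at_top[of 0] by eventually_elim (rule stable_subordinator_prob_le[OF D], auto)
  ultimately have "prob {\<omega> \<in> space M. D 1 \<omega> \<le> 0} \<le> 0"
    by (intro tendsto_lowerbound[where F = at_top]) auto
  then have "prob {\<omega> \<in> space M. D 1 \<omega> \<le> 0} = 0"
    by (simp add: measure_le_0_iff)
  then have "AE \<omega> in M. \<not> D 1 \<omega> \<le> 0"
    by (subst (asm) prob_eq_0) auto
  then show ?thesis by (simp add: not_le)
qed

lemma stable_subordinator_AE_unbounded:
  assumes D: "stable_subordinator \<alpha> D"
  shows "AE \<omega> in M. \<exists>u>0. t < D u \<omega>"
proof -
  have [measurable]: "D (real (Suc n)) \<in> borel_measurable M" for n
    using D by (auto simp: stable_subordinator_def subordinator_def)
  let ?A = "{\<omega> \<in> space M. \<forall>n. D (real (Suc n)) \<omega> \<le> t}"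
  have "(\<lambda>n. exp (1 * t - real (Suc n) * 1 powr \<alpha>)) \<longlonglongrightarrow> 0"
    by real_asymp
  moreover have "prob ?A \<le> exp (1 * t - real (Suc n) * 1 powr \<alpha>)" for n
  proof -
    have "prob ?A \<le> prob {\<omega> \<in> space M. D (real (Suc n)) \<omega> \<le> t}"
      by (intro finite_measure_mono) (auto simp del: of_nat_Suc)
    also have "\<dots> \<le> exp (1 * t - real (Suc n) * 1 powr \<alpha>)"
      by (rule stable_subordinator_prob_le[OF D]) auto
    finally show ?thesis .
  qed
  ultimately have "prob ?A \<le> 0"
    by (intro tendsto_lowerbound[where F = sequentially]) auto
  then have "prob ?A = 0"
    by (simp add: measure_le_0_iff)
  then have "AE \<omega> in M. \<omega> \<notin> ?A"
    by (subst (asm) prob_eq_0) (simp_all del: of_nat_Suc)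
  then show ?thesis
    using AE_space
  proof eventually_elim
    case (elim \<omega>)
    then obtain n where "t < D (real (Suc n)) \<omega>" by (auto simp: not_le simp del: of_nat_Suc)
    then show ?case by (intro exI[of _ "real (Suc n)"]) auto
  qed
qed

text \<open>Unboundedness makes the set nonempty almost surely, so its lower bound 0 passes to the
  infimum; \<open>Inf\<close> of an empty set would carry no sign information.\<close>

lemma inverse_stable_subordinator_AE_nonneg:
  assumes L: "inverse_stable_subordinator \<alpha> L" and t: "0 \<le> t"
  shows "AE \<omega> in M. 0 \<le> L t \<omega>"
proof -
  obtain D where D: "stable_subordinator \<alpha> D"
      and LD: "\<And>\<omega>. \<omega> \<in> space M \<Longrightarrow> L t \<omega> = Inf {u. 0 < u \<and> t < D u \<omega>}"
    using L t by (auto simp: inverse_stable_subordinator_def)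
  show ?thesis
    using stable_subordinator_AE_unbounded[OF D, of t] AE_space
  proof eventually_elim
    case (elim \<omega>)
    then show ?case by (auto simp: LD intro!: cInf_greatest)
  qed
qed

text \<open>
  Up to events with \<open>L t = u\<close>, the events \<open>L t > u\<close> and \<open>D u \<le> t\<close> agree, and \<open>D u\<close> has
  the law of \<open>u powr (1 / \<alpha>) * D 1\<close>.
\<close>

lemma inverse_stable_subordinator_law:
  assumes D: "stable_subordinator \<alpha> D" and \<alpha>: "0 < \<alpha>" and t: "0 \<le> t"
    and [measurable]: "X \<in> borel_measurable M"
    and X: "\<And>\<omega>. \<omega> \<in> space M \<Longrightarrow> X \<omega> = Inf {u. 0 < u \<and> t < D u \<omega>}"
  shows "distr M borel X = distr M borel (\<lambda>\<omega>. (t / D 1 \<omega>) powr \<alpha>)"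
proof -
  let ?Y = "\<lambda>\<omega>. (t / D 1 \<omega>) powr \<alpha>"
  have sub: "subordinator D" using D by (simp add: stable_subordinator_def)
  then have [measurable]: "D u \<in> borel_measurable M" if "0 \<le> u" for u
    using that by (auto simp: subordinator_def)
  have [measurable]: "D 1 \<in> borel_measurable M" by simp
  have cdf: "cdf (distr M borel Z) x = prob {\<omega> \<in> space M. Z \<omega> \<le> x}"
    if [measurable]: "Z \<in> borel_measurable M" for Z :: "'a \<Rightarrow> real" and x
    by (simp add: cdf_def measure_distr vimage_def Int_def conj_commute)
  have nonneg: "AE \<omega> in M. 0 \<le> X \<omega>"
    using stable_subordinator_AE_unbounded[OF D, of t] AE_space
  proof eventually_elim
    case (elim \<omega>)
    then show ?case by (auto simp: X intro!: cInf_greatest)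
  qed
  \<comment> \<open>Scaling replaces \<open>D y\<close> by
    \<open>y powr (1 / \<alpha>) * D 1\<close>; almost sure positivity of \<open>D 1\<close> permits
    dividing by it before raising to the power \<alpha>.\<close>
  have key: "prob {\<omega> \<in> space M. t < D y \<omega>} = prob {\<omega> \<in> space M. ?Y \<omega> < y}" if y: "0 < y" for y
  proof -
    have [measurable]: "D y \<in> borel_measurable M" using y by simp
    have "prob {\<omega> \<in> space M. t < D y \<omega>} = measure (distr M borel (D y)) {t<..}"
      by (simp add: measure_distr vimage_def Int_def conj_commute)
    also have "\<dots> = prob {\<omega> \<in> space M. t < y powr (1 / \<alpha>) * D 1 \<omega>}"
      unfolding stable_subordinator_scaling[OF D \<alpha> y]
      by (simp add: measure_distr vimage_def Int_def conj_commute)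
    also have "\<dots> = prob {\<omega> \<in> space M. ?Y \<omega> < y}"
    proof (rule finite_measure_eq_AE)
      show "AE \<omega> in M. (\<omega> \<in> {\<omega> \<in> space M. t < y powr (1 / \<alpha>) * D 1 \<omega>}) =
          (\<omega> \<in> {\<omega> \<in> space M. ?Y \<omega> < y})"
        using stable_subordinator_AE_pos[OF D \<alpha>]
      proof eventually_elim
        case (elim \<omega>)
        have "t < y powr (1 / \<alpha>) * D 1 \<omega> \<longleftrightarrow> t / D 1 \<omega> < y powr (1 / \<alpha>)"
          using elim by (simp add: field_simps)
        also have "\<dots> \<longleftrightarrow> ?Y \<omega> < (y powr (1 / \<alpha>)) powr \<alpha>"
          using powr_less_mono2[OF \<alpha>, of "t / D 1 \<omega>" "y powr (1 / \<alpha>)"]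
            powr_mono2[of \<alpha> "y powr (1 / \<alpha>)" "t / D 1 \<omega>"] elim t \<alpha> by fastforce
        also have "(y powr (1 / \<alpha>)) powr \<alpha> = y"
          using y \<alpha> by (simp add: powr_powr)
        finally show ?case by auto
      qed
    qed auto
    finally show ?thesis .
  qed
  show ?thesis
  proof (rule real_distribution_eqI_shifted_cdf)
    show "real_distribution (distr M borel X)" "real_distribution (distr M borel ?Y)"
      by (auto intro!: real_distribution_distr)
    fix x y :: real assume xy: "x < y"
    show "cdf (distr M borel X) x \<le> cdf (distr M borel ?Y) y"
    proof (cases "0 < y")
      case True
      then have [measurable]: "D y \<in> borel_measurable M" by simp
      \<comment> \<open>An infimum below \<open>y\<close> leaves some \<open>v < y\<close> with
        \<open>t < D v \<omega>\<close>, and monotone paths carry this to \<open>y\<close>.\<close>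
      have "prob {\<omega> \<in> space M. X \<omega> \<le> x} \<le> prob {\<omega> \<in> space M. t < D y \<omega>}"
      proof (rule finite_measure_mono_AE)
        show "AE \<omega> in M. \<omega> \<in> {\<omega> \<in> space M. X \<omega> \<le> x} \<longrightarrow> \<omega> \<in> {\<omega> \<in> space M. t < D y \<omega>}"
          using subordinator_AE[OF sub] stable_subordinator_AE_unbounded[OF D, of t]
        proof eventually_elim
          case (elim \<omega>)
          show ?case
          proof (intro impI)
            assume \<omega>: "\<omega> \<in> {\<omega> \<in> space M. X \<omega> \<le> x}"
            then have "Inf {u. 0 < u \<and> t < D u \<omega>} < y" using xy X[of \<omega>] by simp
            then obtain v where "0 < v" "t < D v \<omega>" "v < y"
              using elim(2) by (subst (asm) cInf_less_iff) (auto intro!: bdd_belowI[of _ 0])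
            with elim(1) \<omega> show "\<omega> \<in> {\<omega> \<in> space M. t < D y \<omega>}"
              by (auto intro!: less_le_trans[of t "D v \<omega>" "D y \<omega>"])
          qed
        qed
      qed auto
      also have "\<dots> = prob {\<omega> \<in> space M. ?Y \<omega> < y}" by (rule key[OF True])
      also have "\<dots> \<le> prob {\<omega> \<in> space M. ?Y \<omega> \<le> y}" by (intro finite_measure_mono) auto
      finally show ?thesis by (simp add: cdf)
    next
      case False
      have "prob {\<omega> \<in> space M. X \<omega> \<le> x} = 0"
        using nonneg xy False by (subst prob_eq_0) (auto elim!: eventually_mono)
      then show ?thesis by (simp add: cdf)
    qed
    show "cdf (distr M borel ?Y) x \<le> cdf (distr M borel X) y"
    proof (cases "0 < y")
      case True
      then have [measurable]: "D y \<in> borel_measurable M" by simp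
      have "prob {\<omega> \<in> space M. ?Y \<omega> \<le> x} \<le> prob {\<omega> \<in> space M. ?Y \<omega> < y}"
        using xy by (intro finite_measure_mono) auto
      also have "\<dots> = prob {\<omega> \<in> space M. t < D y \<omega>}" by (rule key[OF True, symmetric])
      \<comment> \<open>If \<open>t < D y \<omega>\<close>, then \<open>y\<close> itself belongs to
        the set, so the infimum is at most \<open>y\<close>.\<close>
      also have "\<dots> \<le> prob {\<omega> \<in> space M. X \<omega> \<le> y}"
        using True by (intro finite_measure_mono) (auto simp: X intro!: cInf_lower bdd_belowI[of _ 0])
      finally show ?thesis by (simp add: cdf)
    next
      case False
      have empty: "{\<omega> \<in> space M. ?Y \<omega> \<le> x} = {}"
        using xy False by (auto simp: not_le intro: less_le_trans[of x 0])
      have "prob {\<omega> \<in> space M. ?Y \<omega> \<le> x} = 0" unfolding empty by simp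
      then show ?thesis by (simp add: cdf)
    qed
  qed
qed

text \<open>The mixture representation of x^(-s) is averaged over x = \<open>D 1\<close>; the inner
  expectation is exp(-w^\<alpha>). Everything is nonnegative, so Tonelli's theorem applies and
  finiteness of the moment is part of the outcome.\<close>

lemma stable_subordinator_neg_moment:
  assumes D: "stable_subordinator \<alpha> D" and \<alpha>: "0 < \<alpha>" and s: "0 < s"
  shows "has_bochner_integral M (\<lambda>\<omega>. D 1 \<omega> powr (- s)) (Gamma (s / \<alpha>) / (\<alpha> * Gamma s))"
proof (rule has_bochner_integral_nn_integral)
  have [measurable]: "D 1 \<in> borel_measurable M"
    using D by (auto simp: stable_subordinator_def subordinator_def)
  show "(\<lambda>\<omega>. D 1 \<omega> powr (- s)) \<in> borel_measurable M" by measurable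
  show "AE \<omega> in M. 0 \<le> D 1 \<omega> powr (- s)" by simp
  have Gs: "0 < Gamma s" "0 < Gamma (s / \<alpha>)" using s \<alpha> by (auto intro!: Gamma_real_pos)
  then show "0 \<le> Gamma (s / \<alpha>) / (\<alpha> * Gamma s)" using \<alpha> by simp
  let ?k = "\<lambda>w x. ennreal (indicator {0<..} w * (w powr (s - 1) * exp (- w * x)))"
  have "(\<integral>\<^sup>+\<omega>. ennreal (Gamma s) * ennreal (D 1 \<omega> powr (- s)) \<partial>M) =
      (\<integral>\<^sup>+\<omega>. (\<integral>\<^sup>+w. ?k w (D 1 \<omega>) \<partial>lborel) \<partial>M)"
  proof (rule nn_integral_cong_AE)
    show "AE \<omega> in M. ennreal (Gamma s) * ennreal (D 1 \<omega> powr (- s)) = (\<integral>\<^sup>+w. ?k w (D 1 \<omega>) \<partial>lborel)"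
      using stable_subordinator_AE_pos[OF D \<alpha>]
    proof eventually_elim
      case (elim \<omega>)
      show ?case
        unfolding nn_integral_Gamma_scaled[OF s elim] using Gs by (simp add: ennreal_mult')
    qed
  qed
  also have "\<dots> = (\<integral>\<^sup>+w. (\<integral>\<^sup>+\<omega>. ?k w (D 1 \<omega>) \<partial>M) \<partial>lborel)"
  proof -
    interpret pair_sigma_finite lborel M by standard
    show ?thesis by (rule Fubini') measurable
  qed
  also have "\<dots> = (\<integral>\<^sup>+w. ennreal (indicator {0<..} w * (w powr (s - 1) * exp (- (w powr \<alpha>)))) \<partial>lborel)"
  proof (rule nn_integral_cong)
    fix w :: real
    show "(\<integral>\<^sup>+\<omega>. ?k w (D 1 \<omega>) \<partial>M) = ennreal (indicator {0<..} w * (w powr (s - 1) * exp (- (w powr \<alpha>))))"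
    proof (cases "0 < w")
      case True
      have "(\<integral>\<^sup>+\<omega>. ennreal (exp (- w * D 1 \<omega>)) \<partial>M) = ennreal (expectation (\<lambda>\<omega>. exp (- w * D 1 \<omega>)))"
        by (intro nn_integral_eq_integral stable_subordinator_integrable[OF D]) (use True in auto)
      also have "expectation (\<lambda>\<omega>. exp (- w * D 1 \<omega>)) = exp (- (w powr \<alpha>))"
        using D True by (simp add: stable_subordinator_def)
      finally show ?thesis
        using True by (simp add: ennreal_mult' nn_integral_cmult)
    qed simp
  qed
  also have "\<dots> = ennreal (Gamma (s / \<alpha>) / \<alpha>)"
    by (rule nn_integral_stretched_exp[OF s \<alpha>])
  finally have "ennreal (1 / Gamma s) * (ennreal (Gamma s) * (\<integral>\<^sup>+\<omega>. ennreal (D 1 \<omega> powr (- s)) \<partial>M)) =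
      ennreal (1 / Gamma s) * ennreal (Gamma (s / \<alpha>) / \<alpha>)"
    by (simp add: nn_integral_cmult)
  moreover have "ennreal (1 / Gamma s) * ennreal (Gamma s) = 1"
    using Gs by (simp add: ennreal_mult'[symmetric])
  moreover have "ennreal (1 / Gamma s) * ennreal (Gamma (s / \<alpha>) / \<alpha>) = ennreal (Gamma (s / \<alpha>) / (\<alpha> * Gamma s))"
    using Gs by (subst ennreal_mult'[symmetric]) (auto simp: mult.commute)
  ultimately show "(\<integral>\<^sup>+\<omega>. ennreal (D 1 \<omega> powr (- s)) \<partial>M) = ennreal (Gamma (s / \<alpha>) / (\<alpha> * Gamma s))"
    by (simp only: mult.assoc[symmetric] mult_1_left)
qed

text \<open>By the law of \<open>L t\<close>, its \<open>m\<close>-th moment is (t^\<alpha>)^m times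
  the negative moment of \<open>D 1\<close> of order \<alpha> m. The case \<open>m = 0\<close>
  stands apart because that order must be positive.\<close>

lemma inverse_stable_subordinator_moment:
  assumes L: "inverse_stable_subordinator \<alpha> L" and \<alpha>: "0 < \<alpha>" and t: "0 \<le> t"
    and [measurable]: "L t \<in> borel_measurable M"
  shows "has_bochner_integral M (\<lambda>\<omega>. L t \<omega> ^ m) (fact m * (t powr \<alpha>) ^ m / Gamma (\<alpha> * real m + 1))"
proof (cases "m = 0")
  case True
  then show ?thesis
    by (simp add: has_bochner_integral_iff prob_space)
next
  case False
  obtain D where D: "stable_subordinator \<alpha> D"
      and LD: "\<And>\<omega>. \<omega> \<in> space M \<Longrightarrow> L t \<omega> = Inf {u. 0 < u \<and> t < D u \<omega>}"
    using L t by (auto simp: inverse_stable_subordinator_def)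
  have [measurable]: "D 1 \<in> borel_measurable M"
    using D by (auto simp: stable_subordinator_def subordinator_def)
  let ?s = "\<alpha> * real m"
  have s: "0 < ?s" using \<alpha> False by simp
  have law: "distr M borel (L t) = distr M borel (\<lambda>\<omega>. (t / D 1 \<omega>) powr \<alpha>)"
    by (rule inverse_stable_subordinator_law[OF D \<alpha> t _ LD]) auto
  \<comment> \<open>Gamma(m) = (m-1)!; multiplying numerator and denominator by m turns \<alpha> m
    Gamma(\<alpha> m) into Gamma(\<alpha> m + 1).\<close>
  have "Gamma (?s / \<alpha>) / (\<alpha> * Gamma ?s) = fact m / Gamma (?s + 1)"
  proof -
    have "Gamma (?s / \<alpha>) = fact (m - 1)"
      using \<alpha> False Gamma_fact[of "m - 1", where 'a = real] by simp
    moreover have "fact m = real m * fact (m - 1)"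
      using False by (simp add: fact_reduce)
    ultimately show ?thesis
      using \<alpha> False by (simp add: Gamma_plus1_pos[OF s])
  qed
  then have "has_bochner_integral M (\<lambda>\<omega>. (t powr \<alpha>) ^ m * D 1 \<omega> powr (- ?s))
      ((t powr \<alpha>) ^ m * (fact m / Gamma (?s + 1)))"
    using stable_subordinator_neg_moment[OF D \<alpha> s] by (intro has_bochner_integral_mult_right) simp
  also have "?this \<longleftrightarrow> has_bochner_integral M (\<lambda>\<omega>. ((t / D 1 \<omega>) powr \<alpha>) ^ m)
      ((t powr \<alpha>) ^ m * (fact m / Gamma (?s + 1)))"
  proof (rule has_bochner_integral_cong_AE)
    show "AE \<omega> in M. (t powr \<alpha>) ^ m * D 1 \<omega> powr (- ?s) = ((t / D 1 \<omega>) powr \<alpha>) ^ m"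
      using stable_subordinator_AE_pos[OF D \<alpha>]
    proof eventually_elim
      case (elim \<omega>)
      have "D 1 \<omega> powr (- ?s) = 1 / (D 1 \<omega> powr \<alpha>) ^ m"
        using elim by (simp add: powr_minus powr_power_mult field_simps)
      then show ?case
        using elim t by (simp add: powr_divide power_divide)
    qed
  qed auto
  also have "\<dots> \<longleftrightarrow> has_bochner_integral (distr M borel (\<lambda>\<omega>. (t / D 1 \<omega>) powr \<alpha>)) (\<lambda>x. x ^ m)
      ((t powr \<alpha>) ^ m * (fact m / Gamma (?s + 1)))"
    by (simp add: has_bochner_integral_iff integrable_distr_eq integral_distr)
  also have "\<dots> \<longleftrightarrow> has_bochner_integral M (\<lambda>\<omega>. L t \<omega> ^ m) ((t powr \<alpha>) ^ m * (fact m / Gamma (?s + 1)))"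
    unfolding law[symmetric] by (simp add: has_bochner_integral_iff integrable_distr_eq integral_distr)
  finally show ?thesis by (simp add: mult.commute)
qed

text \<open>Termwise integration of the Taylor series: the factorial in the moment of order
  \<open>r\<close> cancels the one in the series. Since \<open>L t\<close> is almost surely
  nonnegative, absolute moments are moments, and their weighted series converges.\<close>

lemma inverse_stable_subordinator_moment_exp:
  assumes L: "inverse_stable_subordinator \<alpha> L" and \<alpha>: "0 < \<alpha>" and t: "0 \<le> t"
    and [measurable]: "L t \<in> borel_measurable M"
  shows "has_bochner_integral M (\<lambda>\<omega>. L t \<omega> ^ m * exp (- c * L t \<omega>))
    (\<Sum>r. ml_coeff m c r / Gamma (\<alpha> * real r + 1) * (t powr \<alpha>) ^ r)"
proof -
  let ?h = "\<lambda>r \<omega>. ml_coeff m c r / fact r * L t \<omega> ^ r"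
  have moment: "has_bochner_integral M (\<lambda>\<omega>. a / fact r * L t \<omega> ^ r)
      (a / Gamma (\<alpha> * real r + 1) * (t powr \<alpha>) ^ r)" for a r
    using has_bochner_integral_mult_right[OF inverse_stable_subordinator_moment[OF L \<alpha> t], of "a / fact r" r]
    by simp
  have "has_bochner_integral M (\<lambda>\<omega>. norm (?h r \<omega>))
      (norm (ml_coeff m c r / Gamma (\<alpha> * real r + 1) * (t powr \<alpha>) ^ r))" for r
  proof -
    have "AE \<omega> in M. norm (?h r \<omega>) = \<bar>ml_coeff m c r\<bar> / fact r * L t \<omega> ^ r"
      using inverse_stable_subordinator_AE_nonneg[OF L t] by eventually_elim (simp add: abs_mult)
    then have "has_bochner_integral M (\<lambda>\<omega>. norm (?h r \<omega>)) x \<longleftrightarrow>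
        has_bochner_integral M (\<lambda>\<omega>. \<bar>ml_coeff m c r\<bar> / fact r * L t \<omega> ^ r) x" for x
      by (intro has_bochner_integral_cong_AE) auto
    with moment[of "\<bar>ml_coeff m c r\<bar>" r] Gamma_mult_add_one_pos[OF \<alpha>, of r] show ?thesis
      by (simp add: abs_mult)
  qed
  then have norm: "expectation (\<lambda>\<omega>. norm (?h r \<omega>)) =
      norm (ml_coeff m c r / Gamma (\<alpha> * real r + 1) * (t powr \<alpha>) ^ r)" for r
    by (rule has_bochner_integral_integral_eq)
  have int: "integrable M (?h r)" for r
    using moment[of "ml_coeff m c r" r] by (rule integrable.intros)
  have sums: "(\<lambda>r. ?h r \<omega>) sums (L t \<omega> ^ m * exp (- c * L t \<omega>))" for \<omega>
    by (rule ml_coeff_exp_sums)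
  have summable: "summable (\<lambda>r. norm (?h r \<omega>))" for \<omega>
  proof -
    \<comment> \<open>Absolute values give the series of
      \<open>x ^ m * exp (\<bar>c\<bar> * x)\<close> at \<open>x = \<bar>L t \<omega>\<bar>\<close>,
      convergent for every \<open>\<omega>\<close>.\<close>
    have "norm (?h r \<omega>) = ml_coeff m (- \<bar>c\<bar>) r / fact r * \<bar>L t \<omega>\<bar> ^ r" for r
      by (simp add: ml_coeff_def abs_mult power_abs)
    then show ?thesis
      using ml_coeff_exp_sums[of m "- \<bar>c\<bar>" "\<bar>L t \<omega>\<bar>"] by (simp add: sums_iff)
  qed
  have summable_norm: "summable (\<lambda>r. expectation (\<lambda>\<omega>. norm (?h r \<omega>)))"
    unfolding norm by (rule summable_mittag_leffler_coeff[OF \<alpha> ml_coeff_bound])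
  have "integrable M (\<lambda>\<omega>. \<Sum>r. ?h r \<omega>)"
    "expectation (\<lambda>\<omega>. \<Sum>r. ?h r \<omega>) = (\<Sum>r. expectation (?h r))"
    by (rule integrable_suminf integral_suminf; use int summable summable_norm in auto)+
  then show ?thesis
    using sums_unique[OF sums] has_bochner_integral_integral_eq[OF moment]
    by (simp add: has_bochner_integral_iff)
qed

end

section \<open>Monotone fields at random times\<close>

text \<open>The inclusions force \<open>I\<close> and \<open>U\<close> to have the same measure
  \<open>e\<close>, so \<open>A\<close> differs from \<open>I\<close> by a subset of the null set
  \<open>U - I\<close>.\<close>

lemma (in finite_measure) completion_sandwich:
  assumes [measurable]: "I \<in> sets M" "U \<in> sets M"
    and "I \<subseteq> A" "A \<subseteq> U" "measure M U \<le> e" "e \<le> measure M I"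
  shows "A \<in> sets (completion M)" "measure (completion M) A = e"
proof -
  have IU: "I \<subseteq> U" using assms by blast
  have "measure M (U - I) = 0"
    using assms finite_measure_Diff[OF _ _ IU] finite_measure_mono[OF IU] by (simp add: antisym)
  then have "U - I \<in> null_sets M"
    by (simp add: null_sets_def emeasure_eq_measure)
  then show A: "A \<in> sets (completion M)"
    using assms by (intro sets_completionI[of A I "A - I" "U - I"]) auto
  have fin: "U \<in> fmeasurable (completion M)" "A \<in> fmeasurable (completion M)"
    using A assms emeasure_mono[of A U "completion M"]
    by (auto simp: fmeasurable_def emeasure_eq_measure less_top[symmetric] top_unique)
  have "measure (completion M) I \<le> measure (completion M) A"
    using fin A assms by (intro measure_mono_fmeasurable) auto
  moreover have "measure (completion M) A \<le> measure (completion M) U"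
    using fin A assms by (intro measure_mono_fmeasurable) auto
  ultimately show "measure (completion M) A = e"
    using assms by simp
qed

lemma borel_measurable_vec_lambda:
  fixes f :: "'d::finite \<Rightarrow> 'a \<Rightarrow> real"
  assumes "\<And>i. f i \<in> borel_measurable M"
  shows "(\<lambda>x. \<chi> i. f i x) \<in> borel_measurable M"
  using assms by (subst borel_measurable_euclidean_space) (auto simp: Basis_vec_def inner_axis)

lemma countable_range_discretization:
  fixes g :: "int \<Rightarrow> real" and f :: "real \<Rightarrow> int"
  shows "countable (range (\<lambda>x :: real ^ 'd. \<chi> i. g (f (x $ i))))"
proof (rule countable_subset)
  show "range (\<lambda>x :: real ^ 'd. \<chi> i. g (f (x $ i))) \<subseteq> range (\<lambda>h :: 'd \<Rightarrow> int. \<chi> i. g (h i))"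
    by auto
qed simp

context prob_space
begin

text \<open>On each of the countably many cells \<open>Y = c\<close> the time is constant, so
  measurability and the product formula at fixed times suffice and joint measurability in time and
  \<open>\<omega>\<close> does not enter.\<close>

lemma countable_random_time:
  fixes N :: "'t \<Rightarrow> 'a \<Rightarrow> int" and Y :: "'a \<Rightarrow> 't"
  assumes C: "countable C" "\<And>\<omega>. \<omega> \<in> space M \<Longrightarrow> Y \<omega> \<in> C"
    and ev: "\<And>c. c \<in> C \<Longrightarrow> {\<omega> \<in> space M. Y \<omega> = c} \<in> events"
      "\<And>c. c \<in> C \<Longrightarrow> {\<omega> \<in> space M. N c \<omega> < z} \<in> events"
    and indep: "\<And>c. c \<in> C \<Longrightarrow> prob ({\<omega> \<in> space M. N c \<omega> < z} \<inter> {\<omega> \<in> space M. Y \<omega> = c}) =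
      H c * prob {\<omega> \<in> space M. Y \<omega> = c}"
    and H: "\<And>c. c \<in> C \<Longrightarrow> 0 \<le> H c" and HY: "integrable M (\<lambda>\<omega>. H (Y \<omega>))"
  shows "{\<omega> \<in> space M. N (Y \<omega>) \<omega> < z} \<in> events"
    and "prob {\<omega> \<in> space M. N (Y \<omega>) \<omega> < z} = expectation (\<lambda>\<omega>. H (Y \<omega>))"
proof -
  let ?E = "\<lambda>c. {\<omega> \<in> space M. N c \<omega> < z} \<inter> {\<omega> \<in> space M. Y \<omega> = c}"
  have eq: "{\<omega> \<in> space M. N (Y \<omega>) \<omega> < z} = (\<Union>c\<in>C. ?E c)"
    using C by auto
  have E: "?E c \<in> events" if "c \<in> C" for c
    using ev that by (intro sets.Int) auto
  then show "{\<omega> \<in> space M. N (Y \<omega>) \<omega> < z} \<in> events"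
    unfolding eq using C by (intro sets.countable_UN') auto
  have "emeasure M {\<omega> \<in> space M. N (Y \<omega>) \<omega> < z} = (\<integral>\<^sup>+c. emeasure M (?E c) \<partial>count_space C)"
    unfolding eq using C E by (intro emeasure_UN_countable) (auto simp: disjoint_family_on_def)
  also have "\<dots> = (\<integral>\<^sup>+c. (\<integral>\<^sup>+\<omega>. ennreal (H c) * indicator {\<omega> \<in> space M. Y \<omega> = c} \<omega> \<partial>M) \<partial>count_space C)"
    using indep ev H by (intro nn_integral_cong)
      (simp add: emeasure_eq_measure nn_integral_cmult ennreal_mult'')
  \<comment> \<open>After the exchange, only the cell \<open>c = Y \<omega>\<close> contributes for
    a given \<open>\<omega>\<close>.\<close>
  also have "\<dots> = (\<integral>\<^sup>+\<omega>. (\<integral>\<^sup>+c. ennreal (H c) * indicator {\<omega> \<in> space M. Y \<omega> = c} \<omega> \<partial>count_space C) \<partial>M)"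
    using C ev by (intro nn_integral_count_space_nn_integral[symmetric]) auto
  also have "\<dots> = (\<integral>\<^sup>+\<omega>. ennreal (H (Y \<omega>)) \<partial>M)"
  proof (rule nn_integral_cong)
    fix \<omega> assume \<omega>: "\<omega> \<in> space M"
    have "(\<integral>\<^sup>+c. ennreal (H c) * indicator {\<omega> \<in> space M. Y \<omega> = c} \<omega> \<partial>count_space C) =
        (\<Sum>c\<in>{Y \<omega>}. ennreal (H c) * indicator {\<omega> \<in> space M. Y \<omega> = c} \<omega>)"
      using C \<omega> by (intro nn_integral_count_space') auto
    then show "(\<integral>\<^sup>+c. ennreal (H c) * indicator {\<omega> \<in> space M. Y \<omega> = c} \<omega> \<partial>count_space C) = ennreal (H (Y \<omega>))"
      using \<omega> by simp
  qed
  also have "\<dots> = ennreal (expectation (\<lambda>\<omega>. H (Y \<omega>)))"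
    using HY C H by (intro nn_integral_eq_integral AE_I2) auto
  finally show "prob {\<omega> \<in> space M. N (Y \<omega>) \<omega> < z} = expectation (\<lambda>\<omega>. H (Y \<omega>))"
    using C H by (simp add: emeasure_eq_measure integral_nonneg_AE)
qed

text \<open>
  A monotone field evaluated at a random time \<open>X\<close> is squeezed between its values at the
  countably valued discretizations of \<open>X\<close> from below and above, for which independence applies;
  continuity of \<open>H\<close> closes the gap, so that the event lies in the completion.
\<close>

lemma monotone_field_at_random_time:
  fixes N :: "real ^ 'd \<Rightarrow> 'a \<Rightarrow> int" and X :: "'a \<Rightarrow> real ^ 'd" and H :: "real ^ 'd \<Rightarrow> real"
  assumes N: "\<And>u. 0 \<le> u \<Longrightarrow> N u \<in> M \<rightarrow>\<^sub>M count_space UNIV"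
    and mono: "\<And>\<omega> s t. \<omega> \<in> space M \<Longrightarrow> 0 \<le> s \<Longrightarrow> s \<le> t \<Longrightarrow> N s \<omega> \<le> N t \<omega>"
    and X[measurable]: "X \<in> borel_measurable M" and X_nonneg: "AE \<omega> in M. 0 \<le> X \<omega>"
    and indep: "\<And>u B. 0 \<le> u \<Longrightarrow> B \<in> sets borel \<Longrightarrow>
      prob ({\<omega> \<in> space M. N u \<omega> < z} \<inter> {\<omega> \<in> space M. X \<omega> \<in> B}) =
      prob {\<omega> \<in> space M. N u \<omega> < z} * prob {\<omega> \<in> space M. X \<omega> \<in> B}"
    and H: "\<And>u. 0 \<le> u \<Longrightarrow> prob {\<omega> \<in> space M. N u \<omega> < z} = H u"
    and cont: "continuous_on UNIV H"
  shows "{\<omega> \<in> space M. N (X \<omega>) \<omega> < z} \<in> sets (completion M)"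
    and "measure (completion M) {\<omega> \<in> space M. N (X \<omega>) \<omega> < z} = expectation (\<lambda>\<omega>. H (X \<omega>))"
proof -
  have [measurable]: "H \<in> borel_measurable borel"
    by (rule borel_measurable_continuous_onI[OF cont])
  have H01: "0 \<le> H u" "H u \<le> 1" if "0 \<le> u" for u
    using that by (simp_all add: H[symmetric])
  have discrete: "{\<omega> \<in> space M. N (Q (X \<omega>)) \<omega> < z} \<in> events \<and>
      prob {\<omega> \<in> space M. N (Q (X \<omega>)) \<omega> < z} = expectation (\<lambda>\<omega>. H (Q (X \<omega>)))"
    if Q[measurable]: "Q \<in> borel_measurable borel" and C: "countable (range Q)" and nn: "\<And>x. 0 \<le> Q x"
    for Q :: "real ^ 'd \<Rightarrow> real ^ 'd"
  proof -
    have nnC: "0 \<le> c" if "c \<in> range Q" for c using that nn by auto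
    have ev: "{\<omega> \<in> space M. Q (X \<omega>) = c} \<in> events" for c by measurable
    have evN: "{\<omega> \<in> space M. N c \<omega> < z} \<in> events" if "c \<in> range Q" for c
    proof -
      have [measurable]: "N c \<in> M \<rightarrow>\<^sub>M count_space UNIV" using N nnC[OF that] by simp
      show ?thesis by measurable
    qed
    have ind: "prob ({\<omega> \<in> space M. N c \<omega> < z} \<inter> {\<omega> \<in> space M. Q (X \<omega>) = c}) =
        H c * prob {\<omega> \<in> space M. Q (X \<omega>) = c}" if c: "c \<in> range Q" for c
    proof -
      have "prob ({\<omega> \<in> space M. N c \<omega> < z} \<inter> {\<omega> \<in> space M. X \<omega> \<in> Q -` {c}}) =
          prob {\<omega> \<in> space M. N c \<omega> < z} * prob {\<omega> \<in> space M. X \<omega> \<in> Q -` {c}}"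
        using measurable_sets[OF Q, of "{c}"] by (intro indep nnC[OF c]) auto
      then show ?thesis using H[OF nnC[OF c]] by simp
    qed
    have int: "integrable M (\<lambda>\<omega>. H (Q (X \<omega>)))"
      using H01[OF nn] by (intro integrable_const_bound[of _ 1] AE_I2) auto
    show ?thesis
      using countable_random_time[where Y = "\<lambda>\<omega>. Q (X \<omega>)", OF C _ ev evN ind H01(1)[OF nnC] int]
      by auto
  qed
  \<comment> \<open>Rounding down and up on a grid of mesh 1 / (m + 1). The \<open>max 0\<close>
    keeps the rounded times in the orthant also on the null set where \<open>X\<close> has a
    negative coordinate.\<close>
  define l where "l m x = (\<chi> i. max 0 (real_of_int \<lfloor>real (Suc m) * x $ i\<rfloor> / real (Suc m)))"
    for m and x :: "real ^ 'd"
  define r where "r m x = (\<chi> i. max 0 (real_of_int \<lceil>real (Suc m) * x $ i\<rceil> / real (Suc m)))"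
    for m and x :: "real ^ 'd"
  have nn: "0 \<le> l m x" "0 \<le> r m x" for m x
    by (auto simp: l_def r_def less_eq_vec_def)
  have [measurable]: "l m \<in> borel_measurable borel" "r m \<in> borel_measurable borel" for m
    unfolding l_def r_def by (intro borel_measurable_vec_lambda; measurable)+
  have range: "countable (range (l m))" "countable (range (r m))" for m
    unfolding l_def r_def by (rule countable_range_discretization)+
  have between: "l m x \<le> x" "x \<le> r m x" if "0 \<le> x" for m x
  proof -
    have "x $ i \<le> real_of_int \<lceil>real (Suc m) * x $ i\<rceil> / real (Suc m)"
      "real_of_int \<lfloor>real (Suc m) * x $ i\<rfloor> / real (Suc m) \<le> x $ i" for i
      by (simp_all add: pos_le_divide_eq pos_divide_le_eq mult.commute[of "x $ i"] del: of_nat_Suc)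
    then show "l m x \<le> x" "x \<le> r m x"
      using that by (auto simp: l_def r_def less_eq_vec_def le_max_iff_disj simp del: of_nat_Suc)
  qed
  have near: "\<bar>l m x $ i - x $ i\<bar> \<le> 1 / real (Suc m)" "\<bar>r m x $ i - x $ i\<bar> \<le> 1 / real (Suc m)"
    if "0 \<le> x" for m x i
  proof -
    define y where "y = real (Suc m) * x $ i"
    have y: "0 \<le> y" "x $ i = y / real (Suc m)"
      using that by (auto simp: y_def less_eq_vec_def)
    have "\<bar>real_of_int \<lfloor>y\<rfloor> - y\<bar> \<le> 1" "\<bar>real_of_int \<lceil>y\<rceil> - y\<bar> \<le> 1" by linarith+
    then have "\<bar>real_of_int \<lfloor>y\<rfloor> - y\<bar> / real (Suc m) \<le> 1 / real (Suc m)"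
      "\<bar>real_of_int \<lceil>y\<rceil> - y\<bar> / real (Suc m) \<le> 1 / real (Suc m)"
      by (intro divide_right_mono; simp)+
    moreover have "l m x $ i = real_of_int \<lfloor>y\<rfloor> / real (Suc m)" "r m x $ i = real_of_int \<lceil>y\<rceil> / real (Suc m)"
      using y by (simp_all add: l_def r_def y_def[symmetric])
    ultimately show "\<bar>l m x $ i - x $ i\<bar> \<le> 1 / real (Suc m)" "\<bar>r m x $ i - x $ i\<bar> \<le> 1 / real (Suc m)"
      by (simp_all add: y(2) diff_divide_distrib[symmetric] abs_divide)
  qed
  have null: "(\<lambda>m. 1 / real (Suc m)) \<longlonglongrightarrow> 0"
    using LIMSEQ_inverse_real_of_nat by (simp add: inverse_eq_divide)
  have lim: "(\<lambda>m. l m x) \<longlonglongrightarrow> x" "(\<lambda>m. r m x) \<longlonglongrightarrow> x" if "0 \<le> x" for x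
    by ((rule vec_tendstoI, rule LIM_zero_cancel, rule Lim_null_comparison[OF _ null],
        use near[OF that] in simp)+)
  have cont': "isCont H x" for x
    using cont by (simp add: continuous_on_eq_continuous_at)
  have conv: "(\<lambda>m. expectation (\<lambda>\<omega>. H (q m (X \<omega>)))) \<longlonglongrightarrow> expectation (\<lambda>\<omega>. H (X \<omega>))"
    if [measurable]: "\<And>m. q m \<in> borel_measurable borel" and nn: "\<And>m x. 0 \<le> q m x"
      and lim: "\<And>x. 0 \<le> x \<Longrightarrow> (\<lambda>m. q m x) \<longlonglongrightarrow> x"
    for q :: "nat \<Rightarrow> real ^ 'd \<Rightarrow> real ^ 'd"
  proof (rule integral_dominated_convergence[where w = "\<lambda>_. 1"])
    show "AE \<omega> in M. (\<lambda>m. H (q m (X \<omega>))) \<longlonglongrightarrow> H (X \<omega>)"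
      using X_nonneg by eventually_elim (intro isCont_tendsto_compose[OF cont'] lim)
    show "AE \<omega> in M. norm (H (q m (X \<omega>))) \<le> 1" for m
      using H01[OF nn] by auto
  qed auto
  let ?e = "expectation (\<lambda>\<omega>. H (X \<omega>))"
  let ?A = "{\<omega> \<in> space M. N (X \<omega>) \<omega> < z}"
  define G where "G = {\<omega> \<in> space M. 0 \<le> X \<omega>}"
  have G_eq: "G = (\<Inter>i. {\<omega> \<in> space M. 0 \<le> X \<omega> $ i})"
    by (auto simp: G_def less_eq_vec_def)
  have G[measurable]: "G \<in> events" unfolding G_eq by measurable
  have probG: "AE \<omega> in M. \<omega> \<in> G"
    using X_nonneg AE_space by eventually_elim (simp add: G_def)
  define I where "I m = {\<omega> \<in> space M. N (r m (X \<omega>)) \<omega> < z}" for m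
  define U where "U m = {\<omega> \<in> space M. N (l m (X \<omega>)) \<omega> < z}" for m
  have I: "I m \<in> events" "prob (I m) = expectation (\<lambda>\<omega>. H (r m (X \<omega>)))" for m
    unfolding I_def using discrete[of "r m"] range nn by auto
  have U: "U m \<in> events" "prob (U m) = expectation (\<lambda>\<omega>. H (l m (X \<omega>)))" for m
    unfolding U_def using discrete[of "l m"] range nn by auto
  \<comment> \<open>The field is larger at the upper grid time, so on \<open>G\<close> the sets
    \<open>I m\<close> lie inside the event and the sets \<open>U m\<close> contain it. Grids of
    different mesh need not be nested; the union and intersection provide one inner and one outer
    set whose probabilities are compared with every \<open>I m\<close> and
    \<open>U m\<close>.\<close>
  let ?I = "(\<Union>m. I m) \<inter> G" and ?U = "(\<Inter>m. U m) \<union> (space M - G)"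
  have events: "?I \<in> events" "?U \<in> events"
    using I(1) U(1) G by auto
  have squeeze: "N (X \<omega>) \<omega> \<le> N (r m (X \<omega>)) \<omega>" "N (l m (X \<omega>)) \<omega> \<le> N (X \<omega>) \<omega>"
    if "\<omega> \<in> space M" "0 \<le> X \<omega>" for \<omega> m
    using that by (auto intro!: mono between nn)
  have "?I \<subseteq> ?A"
    by (auto simp: I_def G_def intro: le_less_trans[OF squeeze(1)])
  moreover have "?A \<subseteq> ?U"
    by (auto simp: U_def G_def intro: le_less_trans[OF squeeze(2)])
  moreover have "prob ?U \<le> ?e"
  proof (rule tendsto_lowerbound)
    show "(\<lambda>m. expectation (\<lambda>\<omega>. H (l m (X \<omega>)))) \<longlonglongrightarrow> ?e"
      by (rule conv) (use nn lim in auto)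
    show "\<forall>\<^sub>F m in sequentially. prob ?U \<le> expectation (\<lambda>\<omega>. H (l m (X \<omega>)))"
    proof (rule always_eventually, rule allI)
      fix m
      have "prob ?U \<le> prob (U m)"
      proof (rule finite_measure_mono_AE)
        show "AE \<omega> in M. \<omega> \<in> ?U \<longrightarrow> \<omega> \<in> U m"
          using probG by eventually_elim auto
      qed (rule U(1))
      then show "prob ?U \<le> expectation (\<lambda>\<omega>. H (l m (X \<omega>)))" by (simp only: U(2))
    qed
  qed simp
  moreover have "?e \<le> prob ?I"
  proof (rule tendsto_upperbound)
    show "(\<lambda>m. expectation (\<lambda>\<omega>. H (r m (X \<omega>)))) \<longlonglongrightarrow> ?e"
      by (rule conv) (use nn lim in auto)
    show "\<forall>\<^sub>F m in sequentially. expectation (\<lambda>\<omega>. H (r m (X \<omega>))) \<le> prob ?I"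
    proof (rule always_eventually, rule allI)
      fix m
      have "prob (I m) \<le> prob ?I"
      proof (rule finite_measure_mono_AE)
        show "AE \<omega> in M. \<omega> \<in> I m \<longrightarrow> \<omega> \<in> ?I"
          using probG by eventually_elim auto
      qed (rule events(1))
      then show "expectation (\<lambda>\<omega>. H (r m (X \<omega>))) \<le> prob ?I" by (simp only: I(2))
    qed
  qed simp
  ultimately show "?A \<in> sets (completion M)" "measure (completion M) ?A = ?e"
    by (rule completion_sandwich[OF events])+
qed

end

section \<open>The fractional process\<close>

text \<open>The expectation of \<open>l ^ m * exp (- c * l)\<close> at the inverse stable time
  \<open>l\<close> belonging to \<open>s\<close>; equivalently m! (s^\<alpha>)^m times the
  Mittag-Leffler function with lower parameters \<alpha>, \<alpha> m + 1 and upper parameter m + 1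
  at -c s^\<alpha>.\<close>

definition ml_moment :: "real \<Rightarrow> real \<Rightarrow> nat \<Rightarrow> real \<Rightarrow> real"
  where "ml_moment \<alpha> c m s = (\<Sum>r. ml_coeff m c r / Gamma (\<alpha> * real r + 1) * (s powr \<alpha>) ^ r)"

lemma ml_moment_sums:
  assumes "0 < \<alpha>"
  shows "(\<lambda>r. ml_coeff m c r / Gamma (\<alpha> * real r + 1) * (s powr \<alpha>) ^ r) sums ml_moment \<alpha> c m s"
  unfolding ml_moment_def
  by (rule summable_sums, rule summable_norm_cancel,
      rule summable_mittag_leffler_coeff[OF assms ml_coeff_bound])

text \<open>The common rate \<open>c\<close> makes the combination a single power series with growth
  bound \<open>K = 1 + \<bar>c\<bar>\<close>, and \<open>ml_coeff_Suc\<close> resolves its index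
  shift. For \<open>m p = 0\<close> the truncated \<open>m p - 1\<close> is multiplied by 0.\<close>

lemma caputo_ml_moments:
  assumes \<alpha>: "0 < \<alpha>" "\<alpha> < 1" and t: "0 < t" and I: "finite I"
    and f: "\<And>s. 0 < s \<Longrightarrow> f s = (\<Sum>p\<in>I. A p * ml_moment \<alpha> c (m p) s)"
  shows "caputo_differentiable \<alpha> f t"
    and "caputo_deriv \<alpha> f t =
      (\<Sum>p\<in>I. A p * (real (m p) * ml_moment \<alpha> c (m p - 1) t - c * ml_moment \<alpha> c (m p) t))"
proof -
  let ?e = "\<lambda>s r. (s powr \<alpha>) ^ r / Gamma (\<alpha> * real r + 1)"
  define b where "b r = (\<Sum>p\<in>I. A p * ml_coeff (m p) c r)" for r
  have sums: "(\<lambda>r. ml_coeff m c r * ?e s r) sums ml_moment \<alpha> c m s" for m s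
    using ml_moment_sums[OF \<alpha>(1), of m c s] by simp
  have bound: "\<bar>b r\<bar> \<le> (\<Sum>p\<in>I. \<bar>A p\<bar> * fact (m p)) * (1 + \<bar>c\<bar>) ^ r" for r
  proof -
    have "\<bar>b r\<bar> \<le> (\<Sum>p\<in>I. \<bar>A p * ml_coeff (m p) c r\<bar>)"
      unfolding b_def by (rule sum_abs)
    also have "\<dots> \<le> (\<Sum>p\<in>I. \<bar>A p\<bar> * (fact (m p) * (1 + \<bar>c\<bar>) ^ r))"
      by (intro sum_mono) (simp add: abs_mult mult_left_mono ml_coeff_bound)
    finally show ?thesis by (simp add: sum_distrib_right mult.assoc)
  qed
  have "f s = (\<Sum>r. b r / Gamma (\<alpha> * real r + 1) * (s powr \<alpha>) ^ r)" if "0 < s" for s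
  proof -
    have "(\<lambda>r. \<Sum>p\<in>I. A p * (ml_coeff (m p) c r * ?e s r)) sums f s"
      unfolding f[OF that] by (intro sums_sum sums_mult sums)
    then show ?thesis
      by (simp add: sums_iff b_def sum_distrib_right sum_divide_distrib mult.assoc)
  qed
  note caputo = caputo_power_series[OF \<alpha> t bound this]
  show "caputo_differentiable \<alpha> f t" by (rule caputo(1))
  have "(\<lambda>r. \<Sum>p\<in>I. A p * (real (m p) * (ml_coeff (m p - 1) c r * ?e t r) - c * (ml_coeff (m p) c r * ?e t r)))
      sums (\<Sum>p\<in>I. A p * (real (m p) * ml_moment \<alpha> c (m p - 1) t - c * ml_moment \<alpha> c (m p) t))"
    by (intro sums_sum sums_mult sums_diff sums)
  moreover have "(\<Sum>p\<in>I. A p * (real (m p) * (ml_coeff (m p - 1) c r * ?e t r) - c * (ml_coeff (m p) c r * ?e t r))) =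
      b (Suc r) / Gamma (\<alpha> * real r + 1) * (t powr \<alpha>) ^ r" for r
  proof -
    define E where "E = ?e t r"
    have "(\<Sum>p\<in>I. A p * (real (m p) * (ml_coeff (m p - 1) c r * E) - c * (ml_coeff (m p) c r * E))) =
        b (Suc r) * E"
      unfolding b_def sum_distrib_right by (intro sum.cong refl) (simp add: ml_coeff_Suc algebra_simps)
    then show ?thesis by (simp add: E_def)
  qed
  ultimately have sums_Suc: "(\<lambda>r. b (Suc r) / Gamma (\<alpha> * real r + 1) * (t powr \<alpha>) ^ r) sums
      (\<Sum>p\<in>I. A p * (real (m p) * ml_moment \<alpha> c (m p - 1) t - c * ml_moment \<alpha> c (m p) t))"
    by (simp only:)
  show "caputo_deriv \<alpha> f t =
      (\<Sum>p\<in>I. A p * (real (m p) * ml_moment \<alpha> c (m p - 1) t - c * ml_moment \<alpha> c (m p) t))"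
    by (rule trans[OF caputo(2) sums_unique[OF sums_Suc, symmetric]])
qed

text \<open>Flattens the double sum to one finite index set, so that linearity of derivatives and
  expectations is applied in one step.\<close>

definition gcp_index :: "nat \<Rightarrow> nat \<Rightarrow> ((nat \<Rightarrow> nat) \<times> (nat \<Rightarrow> 'd::finite \<Rightarrow> nat)) set"
  where "gcp_index k n = (SIGMA x:Omega k n. \<Pi>\<^sub>E j\<in>{1..k}. Theta (x j))"

definition gcp_weight :: "nat \<Rightarrow> (nat \<Rightarrow> real ^ 'd) \<Rightarrow> (nat \<Rightarrow> 'd \<Rightarrow> nat) \<Rightarrow> real"
  where "gcp_weight k \<Lambda> \<nu> = (\<Prod>i\<in>UNIV. \<Prod>j = 1..k. (\<Lambda> j $ i) ^ \<nu> j i / fact (\<nu> j i))"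

definition exp_monomial :: "('d \<Rightarrow> real) \<Rightarrow> ('d::finite \<Rightarrow> nat) \<Rightarrow> real ^ 'd \<Rightarrow> real"
  where "exp_monomial c m u = (\<Prod>i\<in>UNIV. u $ i ^ m i * exp (- c i * u $ i))"

lemma finite_gcp_index: "finite (gcp_index k n)"
  unfolding gcp_index_def by (intro finite_SigmaI finite_Omega finite_PiE finite_Theta) auto

lemma gcp_pmf_eq_exp_monomials:
  "gcp_pmf k \<Lambda> n u = (\<Sum>(x, \<nu>)\<in>gcp_index k n. gcp_weight k \<Lambda> \<nu> *
    exp_monomial (\<lambda>i. \<Sum>j = 1..k. \<Lambda> j $ i) (\<lambda>i. \<Sum>j = 1..k. \<nu> j i) u)"
  unfolding gcp_pmf_expand gcp_index_def gcp_weight_def exp_monomial_def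
  by (subst sum.Sigma) (auto simp: finite_Omega finite_Theta intro!: finite_PiE sum.cong simp: prod.distrib)

lemma has_field_derivative_exp_monomial:
  "((\<lambda>v. exp_monomial c m (vec_upd u i v)) has_field_derivative
    real (m i) * exp_monomial c (m(i := m i - 1)) u - c i * exp_monomial c m u) (at (u $ i))"
proof -
  define R where "R = (\<Prod>l\<in>UNIV - {i}. u $ l ^ m l * exp (- c l * u $ l))"
  \<comment> \<open>The updated point and the lowered exponents agree with \<open>u\<close> and
    \<open>m\<close> off \<open>i\<close>, so all monomials involved share the constant factor
    \<open>R\<close>.\<close>
  have split: "exp_monomial c m' w = w $ i ^ m' i * exp (- c i * w $ i) * R"
    if "\<And>l. l \<noteq> i \<Longrightarrow> w $ l = u $ l \<and> m' l = m l" for w m'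
    unfolding exp_monomial_def R_def by (subst prod.remove[of _ i]) (auto intro!: prod.cong simp: that)
  have "((\<lambda>v. v ^ m i * exp (- c i * v) * R) has_field_derivative
      real (m i) * (u $ i ^ (m i - 1) * exp (- c i * u $ i) * R) -
      c i * (u $ i ^ m i * exp (- c i * u $ i) * R)) (at (u $ i))"
    by (auto intro!: derivative_eq_intros simp: algebra_simps)
  then show ?thesis
    by (simp add: split vec_upd_def)
qed

text \<open>The left side differentiates the monomial expansion, the right side the Poisson form.
  The identity holds at every \<open>u\<close>, so a random time may be inserted before taking
  expectations.\<close>

lemma gcp_pmf_recurrence:
  "(\<Sum>(x, \<nu>)\<in>gcp_index k n. gcp_weight k \<Lambda> \<nu> *
      (real (\<Sum>j = 1..k. \<nu> j i) *
        exp_monomial (\<lambda>i. \<Sum>j = 1..k. \<Lambda> j $ i)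
          ((\<lambda>i. \<Sum>j = 1..k. \<nu> j i)(i := (\<Sum>j = 1..k. \<nu> j i) - 1)) u -
       (\<Sum>j = 1..k. \<Lambda> j $ i) *
        exp_monomial (\<lambda>i. \<Sum>j = 1..k. \<Lambda> j $ i) (\<lambda>i. \<Sum>j = 1..k. \<nu> j i) u)) =
    - (\<Sum>j = 1..k. \<Lambda> j $ i * (gcp_pmf k \<Lambda> n u - (if j \<le> n then gcp_pmf k \<Lambda> (n - j) u else 0)))"
  (is "?D = ?rhs")
proof -
  have "((\<lambda>v. gcp_pmf k \<Lambda> n (vec_upd u i v)) has_field_derivative ?D) (at (u $ i))"
    unfolding gcp_pmf_eq_exp_monomials case_prod_beta
    by (intro DERIV_sum DERIV_cmult has_field_derivative_exp_monomial)
  moreover have upd: "vec_upd u i (u $ i) = u"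
    by (simp add: vec_upd_def vec_eq_iff)
  have "((\<lambda>v. gcp_pmf k \<Lambda> n (vec_upd u i v)) has_field_derivative ?rhs) (at (u $ i))"
    using has_field_derivative_gcp_pmf[of k \<Lambda> n u i "u $ i"] unfolding upd .
  ultimately show ?thesis by (rule DERIV_unique)
qed

lemma continuous_gcp_pmf: "continuous_on UNIV (gcp_pmf k \<Lambda> n)"
  unfolding gcp_pmf_def by (intro continuous_intros) auto

section \<open>Expectations at the multiparameter inverse stable time\<close>

context prob_space
begin

text \<open>Evaluation at \<open>t $ i\<close> is measurable on the product space of paths, so
  independence of the paths passes to their values.\<close>

lemma multiparameter_inverse_stable_subordinator_cases:
  assumes L: "multiparameter_inverse_stable_subordinator \<alpha> L" and t: "0 \<le> t"
  obtains l where "\<And>i. inverse_stable_subordinator (\<alpha> $ i) (l i)"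
    and "indep_vars (\<lambda>_. borel) (\<lambda>i \<omega>. l i (t $ i) \<omega>) UNIV"
    and "\<And>\<omega>. \<omega> \<in> space M \<Longrightarrow> L t \<omega> = (\<chi> i. l i (t $ i) \<omega>)"
proof -
  obtain l where l: "\<And>i. inverse_stable_subordinator (\<alpha> $ i) (l i)"
      "indep_vars (\<lambda>_. Pi\<^sub>M {0..} (\<lambda>_. borel)) (\<lambda>i \<omega>. \<lambda>s\<in>{0..}. l i s \<omega>) UNIV"
      "\<And>t \<omega>. 0 \<le> t \<Longrightarrow> \<omega> \<in> space M \<Longrightarrow> L t \<omega> = (\<chi> i. l i (t $ i) \<omega>)"
    using L by (auto simp: multiparameter_inverse_stable_subordinator_def)
  have ti: "0 \<le> t $ i" for i using t by (simp add: less_eq_vec_def)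
  have "indep_vars (\<lambda>_. borel) (\<lambda>i \<omega>. (\<lambda>s\<in>{0..}. l i s \<omega>) (t $ i)) UNIV"
    by (rule indep_vars_compose2[OF l(2)]) (use ti in \<open>auto intro!: measurable_component_singleton\<close>)
  with ti have "indep_vars (\<lambda>_. borel) (\<lambda>i \<omega>. l i (t $ i) \<omega>) UNIV"
    by simp
  with l t that show ?thesis by blast
qed

lemma multiparameter_inverse_stable_subordinator_measurable:
  assumes L: "multiparameter_inverse_stable_subordinator \<alpha> L" and t: "0 \<le> t"
  shows "L t \<in> borel_measurable M"
proof -
  from L t obtain l where l: "indep_vars (\<lambda>_. borel) (\<lambda>i \<omega>. l i (t $ i) \<omega>) UNIV"
    "\<And>\<omega>. \<omega> \<in> space M \<Longrightarrow> L t \<omega> = (\<chi> i. l i (t $ i) \<omega>)"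
    by (rule multiparameter_inverse_stable_subordinator_cases) blast
  have "(\<lambda>\<omega>. \<chi> i. l i (t $ i) \<omega>) \<in> borel_measurable M"
    using l(1) by (intro borel_measurable_vec_lambda) (auto simp: indep_vars_def)
  then show ?thesis
    using l(2) by (subst measurable_cong)
qed

lemma multiparameter_inverse_stable_subordinator_AE_nonneg:
  assumes L: "multiparameter_inverse_stable_subordinator \<alpha> L" and t: "0 \<le> t"
  shows "AE \<omega> in M. 0 \<le> L t \<omega>"
proof -
  from L t obtain l where l: "\<And>i. inverse_stable_subordinator (\<alpha> $ i) (l i)"
    "\<And>\<omega>. \<omega> \<in> space M \<Longrightarrow> L t \<omega> = (\<chi> i. l i (t $ i) \<omega>)"
    by (rule multiparameter_inverse_stable_subordinator_cases) blast
  have "AE \<omega> in M. \<forall>i\<in>UNIV. 0 \<le> l i (t $ i) \<omega>"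
    using t l by (intro AE_finite_allI inverse_stable_subordinator_AE_nonneg) (auto simp: less_eq_vec_def)
  then show ?thesis
    using AE_space by eventually_elim (simp add: l(2) less_eq_vec_def)
qed

text \<open>The factor of index \<open>i\<close> is a function of the \<open>i\<close>-th coordinate
  of \<open>L t\<close> alone, so independence turns the expectation of the product into a product
  of one-dimensional expectations.\<close>

lemma exp_monomial_expectation:
  assumes L: "multiparameter_inverse_stable_subordinator \<alpha> L" and t: "0 \<le> t"
    and \<alpha>: "\<And>i. 0 < \<alpha> $ i"
  shows "has_bochner_integral M (\<lambda>\<omega>. exp_monomial c m (L t \<omega>))
    (\<Prod>i\<in>UNIV. ml_moment (\<alpha> $ i) (c i) (m i) (t $ i))"
proof -
  from L t obtain l where l: "\<And>i. inverse_stable_subordinator (\<alpha> $ i) (l i)"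
    "indep_vars (\<lambda>_. borel) (\<lambda>i \<omega>. l i (t $ i) \<omega>) UNIV"
    "\<And>\<omega>. \<omega> \<in> space M \<Longrightarrow> L t \<omega> = (\<chi> i. l i (t $ i) \<omega>)"
    by (rule multiparameter_inverse_stable_subordinator_cases) blast
  let ?Y = "\<lambda>i \<omega>. l i (t $ i) \<omega> ^ m i * exp (- c i * l i (t $ i) \<omega>)"
  have Y: "has_bochner_integral M (?Y i) (ml_moment (\<alpha> $ i) (c i) (m i) (t $ i))" for i
    unfolding ml_moment_def using l(1,2) \<alpha> t
    by (intro inverse_stable_subordinator_moment_exp) (auto simp: less_eq_vec_def indep_vars_def)
  have indep: "indep_vars (\<lambda>_. borel) ?Y UNIV"
    by (rule indep_vars_compose2[OF l(2), of "\<lambda>i x. x ^ m i * exp (- c i * x)"]) simp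
  have "has_bochner_integral M (\<lambda>\<omega>. \<Prod>i\<in>UNIV. ?Y i \<omega>)
      (\<Prod>i\<in>UNIV. ml_moment (\<alpha> $ i) (c i) (m i) (t $ i))"
    using indep_vars_lebesgue_integral[OF _ indep] indep_vars_integrable[OF _ indep] Y
    by (simp add: has_bochner_integral_iff)
  then show ?thesis
    by (rule has_bochner_integral_cong[THEN iffD1, rotated 3]) (auto simp: exp_monomial_def l(3))
qed

text \<open>Both events are preimages of cylinder sets under the path maps and hence lie in the
  generated sigma-algebras.\<close>

lemma indep_processes_events:
  assumes "indep_processes N L" "0 \<le> u" "0 \<le> t" "B \<in> sets borel"
  shows "prob ({\<omega> \<in> space M. N u \<omega> < z} \<inter> {\<omega> \<in> space M. L t \<omega> \<in> B}) =
    prob {\<omega> \<in> space M. N u \<omega> < z} * prob {\<omega> \<in> space M. L t \<omega> \<in> B}"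
proof (rule indep_setD[OF assms(1)[unfolded indep_processes_def]])
  let ?PN = "Pi\<^sub>M {0..} (\<lambda>_. count_space UNIV) :: (real ^ 'd \<Rightarrow> int) measure"
  let ?PL = "Pi\<^sub>M {0..} (\<lambda>_. borel) :: (real ^ 'd \<Rightarrow> real ^ 'd) measure"
  have "(\<lambda>f. f u) \<in> ?PN \<rightarrow>\<^sub>M count_space UNIV" "(\<lambda>f. f t) \<in> ?PL \<rightarrow>\<^sub>M borel"
    using assms by (auto intro!: measurable_component_singleton)
  then have *: "(\<lambda>f. f u) -` {..<z} \<inter> space ?PN \<in> sets ?PN" "(\<lambda>f. f t) -` B \<inter> space ?PL \<in> sets ?PL"
    using assms(4) by (auto intro!: measurable_sets)
  have eq1: "{\<omega> \<in> space M. N u \<omega> < z} =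
      (\<lambda>\<omega>. \<lambda>t\<in>{0..}. N t \<omega>) -` ((\<lambda>f. f u) -` {..<z} \<inter> space ?PN) \<inter> space M"
    using assms by (auto simp: space_PiM)
  show "{\<omega> \<in> space M. N u \<omega> < z} \<in>
      sets (vimage_algebra (space M) (\<lambda>\<omega>. \<lambda>t\<in>{0..}. N t \<omega>) ?PN)"
    unfolding eq1 by (rule in_vimage_algebra[OF *(1)])
  have eq2: "{\<omega> \<in> space M. L t \<omega> \<in> B} =
      (\<lambda>\<omega>. \<lambda>t\<in>{0..}. L t \<omega>) -` ((\<lambda>f. f t) -` B \<inter> space ?PL) \<inter> space M"
    using assms by (auto simp: space_PiM)
  show "{\<omega> \<in> space M. L t \<omega> \<in> B} \<in>
      sets (vimage_algebra (space M) (\<lambda>\<omega>. \<lambda>t\<in>{0..}. L t \<omega>) ?PL)"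
    unfolding eq2 by (rule in_vimage_algebra[OF *(2)])
qed

text \<open>Monotone paths squeeze threshold events \<open>N < m\<close>, not events
  \<open>N = n\<close>. The random-time result is therefore applied to the distribution function
  \<open>H\<close>, and the probability of a single value is a difference of two consecutive
  thresholds.\<close>

lemma fractional_GCP_prob_eq_expectation:
  assumes GCP: "multiparameter_GCP k \<Lambda> N"
    and L: "multiparameter_inverse_stable_subordinator \<alpha> L"
    and indep: "indep_processes N L" and t: "0 \<le> t"
  shows "has_bochner_integral M (\<lambda>\<omega>. gcp_pmf k \<Lambda> n (L t \<omega>)) (fractional_GCP_prob M N L (int n) t)"
proof -
  have N_meas[measurable]: "N u \<in> M \<rightarrow>\<^sub>M count_space UNIV" if "0 \<le> u" for u
    using GCP that by (auto simp: multiparameter_GCP_def multiparameter_counting_process_def)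
  have N_nonneg: "0 \<le> N u \<omega>" if "0 \<le> u" "\<omega> \<in> space M" for u \<omega>
    using GCP that by (auto simp: multiparameter_GCP_def multiparameter_counting_process_def)
  have mono: "N s \<omega> \<le> N u \<omega>" if "\<omega> \<in> space M" "0 \<le> s" "s \<le> u" for s u \<omega>
    using GCP that unfolding multiparameter_GCP_def multiparameter_counting_process_def by blast
  have pmf: "prob {\<omega> \<in> space M. N u \<omega> = int r} = gcp_pmf k \<Lambda> r u" if "0 \<le> u" for u r
    using GCP that by (auto simp: multiparameter_GCP_def gcp_pmf_def)
  define H where "H m u = (\<Sum>r<m. gcp_pmf k \<Lambda> r u)" for m u
  have H: "prob {\<omega> \<in> space M. N u \<omega> < int m} = H m u" if u: "0 \<le> u" for u m
  proof -
    note [measurable] = N_meas[OF u]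
    have "{\<omega> \<in> space M. N u \<omega> < int m} = (\<Union>r\<in>{..<m}. {\<omega> \<in> space M. N u \<omega> = int r})"
    proof (intro set_eqI iffI)
      fix \<omega> assume \<omega>: "\<omega> \<in> {\<omega> \<in> space M. N u \<omega> < int m}"
      with N_nonneg[OF u] obtain r where "N u \<omega> = int r" by (auto intro: nonneg_int_cases)
      with \<omega> show "\<omega> \<in> (\<Union>r\<in>{..<m}. {\<omega> \<in> space M. N u \<omega> = int r})" by auto
    qed auto
    also have "prob \<dots> = (\<Sum>r<m. prob {\<omega> \<in> space M. N u \<omega> = int r})"
      by (rule finite_measure_finite_Union) (auto simp: disjoint_family_on_def)
    finally show ?thesis by (simp add: pmf[OF u] H_def)
  qed
  have X[measurable]: "L t \<in> borel_measurable M"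
    by (rule multiparameter_inverse_stable_subordinator_measurable[OF L t])
  have X_nonneg: "AE \<omega> in M. 0 \<le> L t \<omega>"
    by (rule multiparameter_inverse_stable_subordinator_AE_nonneg[OF L t])
  have H_cont: "continuous_on UNIV (H m)" for m
    unfolding H_def by (intro continuous_intros continuous_on_subset[OF continuous_gcp_pmf]) auto
  let ?A = "\<lambda>m. {\<omega> \<in> space M. N (L t \<omega>) \<omega> < int m}"
  have A: "?A m \<in> sets (completion M)"
    "measure (completion M) (?A m) = expectation (\<lambda>\<omega>. H m (L t \<omega>))" for m
    by (rule monotone_field_at_random_time[OF N_meas mono X X_nonneg
        indep_processes_events[OF indep _ t] H H_cont]; assumption)+
  have [measurable]: "gcp_pmf k \<Lambda> r \<in> borel_measurable borel" for r
    by (rule borel_measurable_continuous_onI[OF continuous_gcp_pmf])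
  \<comment> \<open>On the orthant, where \<open>L t\<close> lies almost surely,
    \<open>gcp_pmf\<close> is a probability and so at most 1.\<close>
  have int: "integrable M (\<lambda>\<omega>. gcp_pmf k \<Lambda> r (L t \<omega>))" for r
  proof (rule integrable_const_bound[of _ 1])
    show "AE \<omega> in M. norm (gcp_pmf k \<Lambda> r (L t \<omega>)) \<le> 1"
      using X_nonneg by eventually_elim (simp add: pmf[symmetric])
  qed measurable
  interpret C: prob_space "completion M" by (rule prob_space_completion)
  have meq: "{\<omega> \<in> space M. N (L t \<omega>) \<omega> = int n} = ?A (Suc n) - ?A n" by auto
  have "fractional_GCP_prob M N L (int n) t = measure (completion M) (?A (Suc n) - ?A n)"
    by (simp add: fractional_GCP_prob_def fractional_GCP_def meq)
  also have "\<dots> = measure (completion M) (?A (Suc n)) - measure (completion M) (?A n)"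
    by (intro C.finite_measure_Diff A(1)) auto
  also have "\<dots> = expectation (\<lambda>\<omega>. gcp_pmf k \<Lambda> n (L t \<omega>))"
    unfolding A(2) H_def using int by simp
  finally show ?thesis
    using int by (simp add: has_bochner_integral_iff)
qed

lemma fractional_GCP_prob_formula:
  assumes GCP: "multiparameter_GCP k \<Lambda> N"
    and L: "multiparameter_inverse_stable_subordinator \<alpha> L"
    and indep: "indep_processes N L" and t: "0 \<le> t" and \<alpha>: "\<And>i. 0 < \<alpha> $ i"
  shows "fractional_GCP_prob M N L (int n) t =
    (\<Sum>(x, \<nu>)\<in>gcp_index k n. gcp_weight k \<Lambda> \<nu> *
      (\<Prod>i\<in>UNIV. ml_moment (\<alpha> $ i) (\<Sum>j = 1..k. \<Lambda> j $ i) (\<Sum>j = 1..k. \<nu> j i) (t $ i)))"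
proof -
  have "has_bochner_integral M (\<lambda>\<omega>. gcp_pmf k \<Lambda> n (L t \<omega>))
      (\<Sum>(x, \<nu>)\<in>gcp_index k n. gcp_weight k \<Lambda> \<nu> *
        (\<Prod>i\<in>UNIV. ml_moment (\<alpha> $ i) (\<Sum>j = 1..k. \<Lambda> j $ i) (\<Sum>j = 1..k. \<nu> j i) (t $ i)))"
    unfolding gcp_pmf_eq_exp_monomials case_prod_beta
    by (intro has_bochner_integral_sum has_bochner_integral_mult_right exp_monomial_expectation[OF L t \<alpha>])
  then show ?thesis
    using fractional_GCP_prob_eq_expectation[OF GCP L indep t] has_bochner_integral_eq by blast
qed

text \<open>With the other coordinates fixed, the probability is a finite combination of functions
  \<open>ml_moment\<close> of \<open>s\<close> with the common rate \<open>?c i\<close>, whose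
  Caputo derivative is explicit. That derivative and the right-hand side are both the expectation of
  \<open>?g (L t)\<close>.\<close>

lemma fractional_GCP_prob_caputo:
  fixes t :: "real ^ 'd"
  assumes GCP: "multiparameter_GCP k \<Lambda> N"
    and L: "multiparameter_inverse_stable_subordinator \<alpha> L"
    and indep: "indep_processes N L" and t: "0 \<le> t" "0 < t $ i"
    and \<alpha>: "\<And>i. 0 < \<alpha> $ i" "\<alpha> $ i < 1"
  shows "caputo_differentiable (\<alpha> $ i) (\<lambda>s. fractional_GCP_prob M N L (int n) (vec_upd t i s)) (t $ i)"
    and "caputo_deriv (\<alpha> $ i) (\<lambda>s. fractional_GCP_prob M N L (int n) (vec_upd t i s)) (t $ i) =
      - (\<Sum>j = 1..k. \<Lambda> j $ i * (fractional_GCP_prob M N L (int n) t -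
          fractional_GCP_prob M N L (int n - int j) t))"
proof -
  let ?c = "\<lambda>i. \<Sum>j = 1..k. \<Lambda> j $ i"
  let ?m = "\<lambda>\<nu> i. \<Sum>j = 1..k. \<nu> j i"
  define R where "R \<nu> = (\<Prod>l\<in>UNIV - {i}. ml_moment (\<alpha> $ l) (?c l) (?m \<nu> l) (t $ l))" for \<nu>
  have split: "(\<Prod>l\<in>UNIV. ml_moment (\<alpha> $ l) (?c l) (m' l) (w $ l)) =
      R \<nu> * ml_moment (\<alpha> $ i) (?c i) (m' i) (w $ i)"
    if "\<And>l. l \<noteq> i \<Longrightarrow> w $ l = t $ l \<and> m' l = ?m \<nu> l" for w m' \<nu>
    unfolding R_def by (subst prod.remove[of _ i]) (auto intro!: prod.cong simp: that)
  have "fractional_GCP_prob M N L (int n) (vec_upd t i s) =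
      (\<Sum>p\<in>gcp_index k n. (gcp_weight k \<Lambda> (snd p) * R (snd p)) *
        ml_moment (\<alpha> $ i) (?c i) (?m (snd p) i) s)" if s: "0 < s" for s
  proof -
    have "0 \<le> vec_upd t i s" using s t by (auto simp: vec_upd_def less_eq_vec_def)
    note formula = fractional_GCP_prob_formula[OF GCP L indep this \<alpha>(1)]
    have "(\<Prod>l\<in>UNIV. ml_moment (\<alpha> $ l) (?c l) (?m \<nu> l) (vec_upd t i s $ l)) =
        R \<nu> * ml_moment (\<alpha> $ i) (?c i) (?m \<nu> i) s" for \<nu>
      by (subst split[of _ _ \<nu>]) (simp_all add: vec_upd_def)
    then show ?thesis
      unfolding formula case_prod_beta by (simp add: mult.assoc)
  qed
  note caputo = caputo_ml_moments[OF \<alpha> t(2) finite_gcp_index this]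
  show "caputo_differentiable (\<alpha> $ i) (\<lambda>s. fractional_GCP_prob M N L (int n) (vec_upd t i s)) (t $ i)"
    by (rule caputo(1))
  let ?g = "\<lambda>u. - (\<Sum>j = 1..k. \<Lambda> j $ i * (gcp_pmf k \<Lambda> n u - (if j \<le> n then gcp_pmf k \<Lambda> (n - j) u else 0)))"
  have "has_bochner_integral M (\<lambda>\<omega>. ?g (L t \<omega>))
      (\<Sum>p\<in>gcp_index k n. gcp_weight k \<Lambda> (snd p) *
        (real (?m (snd p) i) *
          (\<Prod>l\<in>UNIV. ml_moment (\<alpha> $ l) (?c l) (((?m (snd p))(i := ?m (snd p) i - 1)) l) (t $ l)) -
         ?c i * (\<Prod>l\<in>UNIV. ml_moment (\<alpha> $ l) (?c l) (?m (snd p) l) (t $ l))))"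
    unfolding gcp_pmf_recurrence[symmetric] case_prod_beta
    by (intro has_bochner_integral_sum has_bochner_integral_mult_right has_bochner_integral_diff
        exp_monomial_expectation[OF L t(1) \<alpha>(1)])
  also have "(\<Sum>p\<in>gcp_index k n. gcp_weight k \<Lambda> (snd p) *
        (real (?m (snd p) i) *
          (\<Prod>l\<in>UNIV. ml_moment (\<alpha> $ l) (?c l) (((?m (snd p))(i := ?m (snd p) i - 1)) l) (t $ l)) -
         ?c i * (\<Prod>l\<in>UNIV. ml_moment (\<alpha> $ l) (?c l) (?m (snd p) l) (t $ l)))) =
      caputo_deriv (\<alpha> $ i) (\<lambda>s. fractional_GCP_prob M N L (int n) (vec_upd t i s)) (t $ i)"
  \<comment> \<open>The Caputo formula alters the factor of coordinate \<open>i\<close> only;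
    multiplying by \<open>R\<close> restores the full products.\<close>
  proof (rule trans[OF _ caputo(2)[symmetric]], rule sum.cong[OF refl])
    fix p :: "(nat \<Rightarrow> nat) \<times> (nat \<Rightarrow> 'd \<Rightarrow> nat)"
    have "(\<Prod>l\<in>UNIV. ml_moment (\<alpha> $ l) (?c l) (((?m (snd p))(i := ?m (snd p) i - 1)) l) (t $ l)) =
        R (snd p) * ml_moment (\<alpha> $ i) (?c i) (?m (snd p) i - 1) (t $ i)"
      by (subst split[of t _ "snd p"]) auto
    moreover have "(\<Prod>l\<in>UNIV. ml_moment (\<alpha> $ l) (?c l) (?m (snd p) l) (t $ l)) =
        R (snd p) * ml_moment (\<alpha> $ i) (?c i) (?m (snd p) i) (t $ i)"
      by (rule split) auto
    ultimately show "gcp_weight k \<Lambda> (snd p) *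
        (real (?m (snd p) i) *
          (\<Prod>l\<in>UNIV. ml_moment (\<alpha> $ l) (?c l) (((?m (snd p))(i := ?m (snd p) i - 1)) l) (t $ l)) -
         ?c i * (\<Prod>l\<in>UNIV. ml_moment (\<alpha> $ l) (?c l) (?m (snd p) l) (t $ l))) =
        gcp_weight k \<Lambda> (snd p) * R (snd p) *
        (real (?m (snd p) i) * ml_moment (\<alpha> $ i) (?c i) (?m (snd p) i - 1) (t $ i) -
         ?c i * ml_moment (\<alpha> $ i) (?c i) (?m (snd p) i) (t $ i))"
      by (simp only:) (simp add: right_diff_distrib mult_ac)
  qed
  finally have lhs: "has_bochner_integral M (\<lambda>\<omega>. ?g (L t \<omega>))
      (caputo_deriv (\<alpha> $ i) (\<lambda>s. fractional_GCP_prob M N L (int n) (vec_upd t i s)) (t $ i))" .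
  \<comment> \<open>For \<open>j > n\<close> the index \<open>int n - int j\<close> is negative,
    where the probability is 0 by convention, in accordance with the conditional.\<close>
  have shift: "has_bochner_integral M (\<lambda>\<omega>. if j \<le> n then gcp_pmf k \<Lambda> (n - j) (L t \<omega>) else 0)
      (fractional_GCP_prob M N L (int n - int j) t)" for j
  proof (cases "j \<le> n")
    case True
    then show ?thesis
      using fractional_GCP_prob_eq_expectation[OF GCP L indep t(1), of "n - j"] by (simp add: of_nat_diff)
  qed (simp add: fractional_GCP_prob_def has_bochner_integral_iff)
  have "has_bochner_integral M (\<lambda>\<omega>. ?g (L t \<omega>))
      (- (\<Sum>j = 1..k. \<Lambda> j $ i * (fractional_GCP_prob M N L (int n) t -
          fractional_GCP_prob M N L (int n - int j) t)))"
    by (intro has_bochner_integral_minus has_bochner_integral_sum has_bochner_integral_mult_right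
        has_bochner_integral_diff shift fractional_GCP_prob_eq_expectation[OF GCP L indep t(1)])
  with lhs show "caputo_deriv (\<alpha> $ i) (\<lambda>s. fractional_GCP_prob M N L (int n) (vec_upd t i s)) (t $ i) =
      - (\<Sum>j = 1..k. \<Lambda> j $ i * (fractional_GCP_prob M N L (int n) t -
          fractional_GCP_prob M N L (int n - int j) t))"
    by (rule has_bochner_integral_eq)
qed

end

theorem theorem3p3:
  fixes P :: "'a measure"
    and k :: nat
    and \<Lambda> :: "nat \<Rightarrow> real ^ 'd"
    and \<alpha> :: "real ^ 'd"
    and N :: "real ^ 'd \<Rightarrow> 'a \<Rightarrow> int"
    and L :: "real ^ 'd \<Rightarrow> 'a \<Rightarrow> real ^ 'd"
  assumes "prob_space P"
    and "k \<ge> 1"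
    and "\<forall>j\<in>{1..k}. 0 \<prec> \<Lambda> j"
    and "\<forall>i. \<alpha> $ i \<in> {0<..<1}"
    and "prob_space.multiparameter_GCP P k \<Lambda> N"
    and "prob_space.multiparameter_inverse_stable_subordinator P \<alpha> L"
    and "prob_space.indep_processes P N L"
  shows "(\<forall>n::nat. \<forall>t\<ge>0. fractional_GCP_prob P N L (int n) t =
      (\<Sum>x\<in>Omega k n. \<Sum>\<nu>\<in>(\<Pi>\<^sub>E j\<in>{1..k}. Theta (x j)).
        \<Prod>i\<in>UNIV.
          fact (\<Sum>j = 1..k. \<nu> j i) *
          (\<Prod>j = 1..k. (\<Lambda> j $ i * (t $ i) powr (\<alpha> $ i)) ^ \<nu> j i / fact (\<nu> j i)) *
          mittag_leffler3 (\<alpha> $ i) (\<alpha> $ i * real (\<Sum>j = 1..k. \<nu> j i) + 1)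
            (real (\<Sum>j = 1..k. \<nu> j i) + 1)
            (- ((t $ i) powr (\<alpha> $ i)) * (\<Sum>j = 1..k. \<Lambda> j $ i))))
    \<and> (\<forall>i. \<forall>n::nat. \<forall>t\<ge>0. 0 < t $ i \<longrightarrow>
        caputo_differentiable (\<alpha> $ i)
          (\<lambda>s. fractional_GCP_prob P N L (int n) (vec_upd t i s)) (t $ i) \<and>
        caputo_deriv (\<alpha> $ i)
          (\<lambda>s. fractional_GCP_prob P N L (int n) (vec_upd t i s)) (t $ i) =
        - (\<Sum>j = 1..k. \<Lambda> j $ i *
            (fractional_GCP_prob P N L (int n) t
             - fractional_GCP_prob P N L (int n - int j) t)))"
proof (intro conjI allI impI)
  interpret prob_space P by fact
  note GCP = assms(5) and L = assms(6) and indep = assms(7)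
  have \<alpha>: "0 < \<alpha> $ i" "\<alpha> $ i < 1" for i using assms(4) by auto
  {
    fix n :: nat and t :: "real ^ 'd"
    assume t: "0 \<le> t"
    let ?c = "\<lambda>i. \<Sum>j = 1..k. \<Lambda> j $ i"
    let ?m = "\<lambda>\<nu> i. \<Sum>j = 1..k. \<nu> j i"
    let ?T = "\<lambda>\<nu>. \<Prod>i\<in>UNIV.
          fact (?m \<nu> i) *
          (\<Prod>j = 1..k. (\<Lambda> j $ i * (t $ i) powr (\<alpha> $ i)) ^ \<nu> j i / fact (\<nu> j i)) *
          mittag_leffler3 (\<alpha> $ i) (\<alpha> $ i * real (?m \<nu> i) + 1) (real (?m \<nu> i) + 1)
            (- ((t $ i) powr (\<alpha> $ i)) * ?c i)"
    \<comment> \<open>Over \<open>j\<close>, the powers of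
      \<open>(t $ i) powr (\<alpha> $ i)\<close> combine to exponent \<open>?m \<nu> i\<close>, the
      factor \<open>z ^ m\<close> in \<open>mittag_leffler3_eq_suminf\<close>.\<close>
    have "gcp_weight k \<Lambda> \<nu> * (\<Prod>i\<in>UNIV. ml_moment (\<alpha> $ i) (?c i) (?m \<nu> i) (t $ i)) = ?T \<nu>" for \<nu>
      unfolding gcp_weight_def ml_moment_def mittag_leffler3_eq_suminf[OF \<alpha>(1), symmetric]
        prod.distrib[symmetric]
      by (intro prod.cong refl)
        (simp add: power_mult_distrib prod.distrib prod_dividef power_sum)
    then have "fractional_GCP_prob P N L (int n) t = (\<Sum>(x, \<nu>)\<in>gcp_index k n. ?T \<nu>)"
      unfolding fractional_GCP_prob_formula[OF GCP L indep t \<alpha>(1)] by simp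
    also have "\<dots> = (\<Sum>x\<in>Omega k n. \<Sum>\<nu>\<in>(\<Pi>\<^sub>E j\<in>{1..k}. Theta (x j)). ?T \<nu>)"
      unfolding gcp_index_def by (rule sum.Sigma[symmetric]) (auto simp: finite_Omega finite_Theta intro!: finite_PiE)
    finally show "fractional_GCP_prob P N L (int n) t =
        (\<Sum>x\<in>Omega k n. \<Sum>\<nu>\<in>(\<Pi>\<^sub>E j\<in>{1..k}. Theta (x j)). ?T \<nu>)" .
  }
  fix i and n :: nat and t :: "real ^ 'd"
  assume "0 \<le> t" "0 < t $ i"
  note caputo = fractional_GCP_prob_caputo[OF GCP L indep this \<alpha>]
  show "caputo_differentiable (\<alpha> $ i) (\<lambda>s. fractional_GCP_prob P N L (int n) (vec_upd t i s)) (t $ i)"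
    by (rule caputo(1))
  show "caputo_deriv (\<alpha> $ i) (\<lambda>s. fractional_GCP_prob P N L (int n) (vec_upd t i s)) (t $ i) =
      - (\<Sum>j = 1..k. \<Lambda> j $ i * (fractional_GCP_prob P N L (int n) t
         - fractional_GCP_prob P N L (int n - int j) t))"
    by (rule caputo(2))
qed

end
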